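(* Let $A=(a_{ij})_{n\times n}$ be a Cartan matrix such that $a_{ij}\in\{-1,-2,-3,-4\}$ for all $i>j$ and $a_{ij}=-1$ for all $i<j$. Then the Poincaré series $P(A)$ is invariant under exchanging any two entries $a_{ij}$ and $a_{i'j'}$ below the diagonal: if $i>j$, $i'>j'$, and $A'$ is the matrix obtained from $A$ by interchanging the entries in positions $(i,j)$ and $(i',j')$ (all other entries unchanged), then $P(A')=P(A)$.
   Context: A Cartan matrix is an $n\times n$ integer matrix $A=(a_{ij})$ with $a_{ii}=2$ for all $i$, $a_{ij}\le 0$ for $i\ne j$, and $a_{ij}=0\Rightarrow a_{ji}=0$. Its Weyl group is the Coxeter group $W(A)=\langle \sigma_1,\dots,\sigma_n \mid \sigma_i^2=1,\ (\sigma_i\sigma_j)^{m_{ij}}=1\ (i\ne j)\rangle$, where for $i\neq j$ one puts $m_{ij}=2,3,4,6,\infty$ according as $a_{ij}a_{ji}=0,1,2,3,\ge 4$ respectively (no relation if $m_{ij}=\infty$). Let $l(w)$ be the length of $w\in W(A)$ with respect to the generators $\sigma_1,\dots,\sigma_n$. The Poincaré series of $A$ (equivalently of the Kac-Moody Lie algebra $g(A)$) is $P(A)=\sum_{w\in W(A)}t^{l(w)}\in\mathbb{Z}[[t]]$. *)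

theory Defs
  imports
    "Jordan_Normal_Form.Matrix"
    "HOL-Computational_Algebra.Formal_Power_Series"
    "HOL-Library.Extended_Nat"
begin

section \<open>Groups given by generators and relators\<close>

text \<open>
  A letter \<open>(s, True)\<close> stands for the generator \<open>s\<close>, and \<open>(s, False)\<close> for its formal inverse.
\<close>

type_synonym 'a gword = "('a \<times> bool) list"

definition gwords :: "'a set \<Rightarrow> 'a gword set" where
  "gwords S = lists (S \<times> UNIV)"

inductive_set presentation_rel :: "'a set \<Rightarrow> 'a gword set \<Rightarrow> ('a gword \<times> 'a gword) set"
  for S :: "'a set" and R :: "'a gword set"
where
  refl: "u \<in> gwords S \<Longrightarrow> (u, u) \<in> presentation_rel S R"
| sym: "(u, v) \<in> presentation_rel S R \<Longrightarrow> (v, u) \<in> presentation_rel S R"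
| trans: "(u, v) \<in> presentation_rel S R \<Longrightarrow> (v, w) \<in> presentation_rel S R
    \<Longrightarrow> (u, w) \<in> presentation_rel S R"
| cancel: "u \<in> gwords S \<Longrightarrow> v \<in> gwords S \<Longrightarrow> s \<in> S
    \<Longrightarrow> (u @ [(s, b), (s, \<not> b)] @ v, u @ v) \<in> presentation_rel S R"
| relator: "u \<in> gwords S \<Longrightarrow> v \<in> gwords S \<Longrightarrow> r \<in> R
    \<Longrightarrow> (u @ r @ v, u @ v) \<in> presentation_rel S R"

definition word_class :: "'a set \<Rightarrow> 'a gword set \<Rightarrow> 'a gword \<Rightarrow> 'a gword set" where
  "word_class S R u = presentation_rel S R `` {u}"

definition presented_group :: "'a set \<Rightarrow> 'a gword set \<Rightarrow> 'a gword set monoid" where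
  "presented_group S R =
    \<lparr> carrier = gwords S // presentation_rel S R,
      mult = (\<lambda>X Y. \<Union>u\<in>X. \<Union>v\<in>Y. word_class S R (u @ v)),
      one = word_class S R [] \<rparr>"

definition presented_gen :: "'a set \<Rightarrow> 'a gword set \<Rightarrow> 'a \<Rightarrow> 'a gword set" where
  "presented_gen S R s = word_class S R [(s, True)]"

text \<open>
  Length with respect to a set \<open>X\<close> of elements, using products of elements of \<open>X\<close> only; inverses
  need not be allowed, since this is used for sets of involutions.
\<close>

definition word_length :: "('b, 'c) monoid_scheme \<Rightarrow> 'b set \<Rightarrow> 'b \<Rightarrow> nat" where
  "word_length G X w =
    (LEAST k. \<exists>xs. set xs \<subseteq> X \<and> length xs = k \<and> foldr (\<otimes>\<^bsub>G\<^esub>) xs \<one>\<^bsub>G\<^esub> = w)"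


section \<open>Cartan matrices, Weyl groups and Poincare series\<close>

text \<open>Rows and columns are indexed by \<open>0, \<dots>, n - 1\<close>.\<close>

definition cartan_matrix :: "nat \<Rightarrow> int mat \<Rightarrow> bool" where
  "cartan_matrix n A \<longleftrightarrow>
    A \<in> carrier_mat n n \<and>
    (\<forall>i<n. A $$ (i, i) = 2) \<and>
    (\<forall>i<n. \<forall>j<n. i \<noteq> j \<longrightarrow> A $$ (i, j) \<le> 0) \<and>
    (\<forall>i<n. \<forall>j<n. A $$ (i, j) = 0 \<longrightarrow> A $$ (j, i) = 0)"

text \<open>
  For a Cartan matrix the product below is nonnegative, so the last case means that it is at
  least 4.
\<close>

definition coxeter_exponent :: "int mat \<Rightarrow> nat \<Rightarrow> nat \<Rightarrow> enat" where
  "coxeter_exponent A i j =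
    (let p = A $$ (i, j) * A $$ (j, i) in
      if p = 0 then 2 else if p = 1 then 3 else if p = 2 then 4 else if p = 3 then 6 else \<infinity>)"

definition weyl_gens :: "int mat \<Rightarrow> nat set" where
  "weyl_gens A = {..<dim_row A}"

definition weyl_relators :: "int mat \<Rightarrow> nat gword set" where
  "weyl_relators A =
    {[(i, True), (i, True)] | i. i \<in> weyl_gens A} \<union>
    {concat (replicate m [(i, True), (j, True)]) | i j m.
      i \<in> weyl_gens A \<and> j \<in> weyl_gens A \<and> i \<noteq> j \<and> coxeter_exponent A i j = enat m}"

definition weyl_group :: "int mat \<Rightarrow> nat gword set monoid" where
  "weyl_group A = presented_group (weyl_gens A) (weyl_relators A)"

definition simple_reflection :: "int mat \<Rightarrow> nat \<Rightarrow> nat gword set" where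
  "simple_reflection A i = presented_gen (weyl_gens A) (weyl_relators A) i"

definition weyl_length :: "int mat \<Rightarrow> nat gword set \<Rightarrow> nat" where
  "weyl_length A = word_length (weyl_group A) (simple_reflection A ` weyl_gens A)"

definition poincare_series :: "int mat \<Rightarrow> int fps" where
  "poincare_series A =
    Abs_fps (\<lambda>k. int (card {w \<in> carrier (weyl_group A). weyl_length A w = k}))"

definition swap_entries :: "'a mat \<Rightarrow> nat \<times> nat \<Rightarrow> nat \<times> nat \<Rightarrow> 'a mat" where
  "swap_entries A p q =
    mat (dim_row A) (dim_col A) (\<lambda>r. A $$ (if r = p then q else if r = q then p else r))"


section \<open>Well-definedness\<close>

lemma gwords_simps [simp]:
  "[] \<in> gwords S"
  "x # u \<in> gwords S \<longleftrightarrow> fst x \<in> S \<and> u \<in> gwords S"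
  "u @ v \<in> gwords S \<longleftrightarrow> u \<in> gwords S \<and> v \<in> gwords S"
  by (auto simp: gwords_def mem_Times_iff)

context
  fixes S :: "'a set" and R :: "'a gword set"
  assumes R: "R \<subseteq> gwords S"
begin

lemma presentation_rel_in_gwords:
  "(u, v) \<in> presentation_rel S R \<Longrightarrow> u \<in> gwords S \<and> v \<in> gwords S"
  by (induction rule: presentation_rel.induct) (use R in auto)

lemma equiv_presentation_rel: "equiv (gwords S) (presentation_rel S R)"
  by (rule equivI)
    (auto simp: refl_on_def sym_def trans_def dest: presentation_rel_in_gwords
      intro: presentation_rel.intros)

lemma presentation_rel_context:
  assumes "(u, v) \<in> presentation_rel S R" "x \<in> gwords S" "y \<in> gwords S"
  shows "(x @ u @ y, x @ v @ y) \<in> presentation_rel S R"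
  using assms
proof (induction rule: presentation_rel.induct)
  case (cancel u v s b)
  then show ?case
    using presentation_rel.cancel[of "x @ u" S "v @ y" s b R] by simp
next
  case (relator u v r)
  then show ?case
    using presentation_rel.relator[of "x @ u" S "v @ y" r R] by simp
qed (auto intro: presentation_rel.intros)

lemma presentation_rel_append:
  assumes "(u, u') \<in> presentation_rel S R" "(v, v') \<in> presentation_rel S R"
  shows "(u @ v, u' @ v') \<in> presentation_rel S R"
proof -
  have "(u @ v, u' @ v) \<in> presentation_rel S R"
    using presentation_rel_context[OF assms(1), of "[]" v] assms
    by (auto dest: presentation_rel_in_gwords)
  moreover have "(u' @ v, u' @ v') \<in> presentation_rel S R"
    using presentation_rel_context[OF assms(2), of u' "[]"] assms
    by (auto dest: presentation_rel_in_gwords)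
  ultimately show ?thesis by (rule presentation_rel.trans)
qed

lemma word_class_eq_iff:
  "u \<in> gwords S \<Longrightarrow> v \<in> gwords S \<Longrightarrow>
    word_class S R u = word_class S R v \<longleftrightarrow> (u, v) \<in> presentation_rel S R"
  unfolding word_class_def using eq_equiv_class_iff[OF equiv_presentation_rel] by blast

lemma carrier_presented_group:
  "carrier (presented_group S R) = word_class S R ` gwords S"
  by (auto simp: presented_group_def quotient_def word_class_def)

lemma one_presented_group: "\<one>\<^bsub>presented_group S R\<^esub> = word_class S R []"
  by (simp add: presented_group_def)

lemma mult_presented_group:
  assumes "u \<in> gwords S" "v \<in> gwords S"
  shows "word_class S R u \<otimes>\<^bsub>presented_group S R\<^esub> word_class S R v = word_class S R (u @ v)"
proof -
  have eq: "word_class S R (u' @ v') = word_class S R (u @ v)"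
    if "u' \<in> word_class S R u" "v' \<in> word_class S R v" for u' v'
  proof -
    have "(u @ v, u' @ v') \<in> presentation_rel S R"
      using that presentation_rel_append by (auto simp: word_class_def)
    then show ?thesis
      using word_class_eq_iff presentation_rel_in_gwords by blast
  qed
  have "u \<in> word_class S R u" "v \<in> word_class S R v"
    using assms by (auto simp: word_class_def intro: presentation_rel.refl)
  then have "(\<Union>u'\<in>word_class S R u. \<Union>v'\<in>word_class S R v. word_class S R (u' @ v')) =
      word_class S R (u @ v)"
    using eq by blast
  then show ?thesis by (simp add: presented_group_def)
qed

lemma gword_inverse:
  "u \<in> gwords S \<Longrightarrow> \<exists>v \<in> gwords S. (v @ u, []) \<in> presentation_rel S R"
proof (induction u)
  case Nil
  then show ?case by (auto intro!: bexI[of _ "[]"] presentation_rel.refl)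
next
  case (Cons x u)
  then obtain v where v: "v \<in> gwords S" "(v @ u, []) \<in> presentation_rel S R" by auto
  obtain s b where x: "x = (s, b)" by (cases x)
  have "(v @ [(s, \<not> b), (s, \<not> \<not> b)] @ u, v @ u) \<in> presentation_rel S R"
    using Cons.prems v x by (intro presentation_rel.cancel) auto
  then have "((v @ [(s, \<not> b)]) @ x # u, []) \<in> presentation_rel S R"
    using v(2) x by (auto intro: presentation_rel.trans)
  moreover have "v @ [(s, \<not> b)] \<in> gwords S" using Cons.prems v x by auto
  ultimately show ?case by blast
qed

lemma group_presented_group: "group (presented_group S R)"
proof (rule groupI)
  fix X assume "X \<in> carrier (presented_group S R)"
  then obtain u where u: "u \<in> gwords S" "X = word_class S R u"
    by (auto simp: carrier_presented_group)
  obtain v where v: "v \<in> gwords S" "(v @ u, []) \<in> presentation_rel S R"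
    using gword_inverse u by blast
  then have "word_class S R (v @ u) = word_class S R []"
    using u by (subst word_class_eq_iff) auto
  then show "\<exists>Y \<in> carrier (presented_group S R).
      Y \<otimes>\<^bsub>presented_group S R\<^esub> X = \<one>\<^bsub>presented_group S R\<^esub>"
    using u v by (auto simp: carrier_presented_group one_presented_group mult_presented_group
        intro!: bexI[of _ v])
qed (auto simp: carrier_presented_group one_presented_group mult_presented_group)

end

lemma weyl_relators_subset: "weyl_relators A \<subseteq> gwords (weyl_gens A)"
proof -
  have "concat (replicate m [(i, True), (j, True)]) \<in> gwords S"
    if "i \<in> S" "j \<in> S" for m and i j :: nat and S
    using that by (induction m) auto
  then show ?thesis by (auto simp: weyl_relators_def)
qed

lemma group_weyl_group: "group (weyl_group A)"
  unfolding weyl_group_def by (rule group_presented_group[OF weyl_relators_subset])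

lemma weyl_group_generated:
  assumes "w \<in> carrier (weyl_group A)"
  shows "\<exists>xs. set xs \<subseteq> simple_reflection A ` weyl_gens A \<and>
    foldr (\<otimes>\<^bsub>weyl_group A\<^esub>) xs \<one>\<^bsub>weyl_group A\<^esub> = w"
proof -
  let ?S = "weyl_gens A" and ?R = "weyl_relators A"
  note R = weyl_relators_subset[of A]
  have gen: "word_class ?S ?R [(i, b)] = simple_reflection A i" if i: "i \<in> ?S" for i b
  proof (cases b)
    case False
    have "([] @ [(i, True), (i, True)] @ [(i, False)], [] @ [(i, False)]) \<in> presentation_rel ?S ?R"
      using i by (intro presentation_rel.relator) (auto simp: weyl_relators_def)
    moreover have "([(i, True)] @ [(i, True), (i, \<not> True)] @ [], [(i, True)] @ [])
        \<in> presentation_rel ?S ?R"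
      using i by (intro presentation_rel.cancel) auto
    ultimately have "([(i, False)], [(i, True)]) \<in> presentation_rel ?S ?R"
      by simp (blast intro: presentation_rel.sym presentation_rel.trans)
    then show ?thesis
      using False i by (simp add: simple_reflection_def presented_gen_def word_class_eq_iff[OF R])
  qed (simp add: simple_reflection_def presented_gen_def)
  have "\<exists>xs. set xs \<subseteq> simple_reflection A ` ?S \<and>
      foldr (\<otimes>\<^bsub>weyl_group A\<^esub>) xs \<one>\<^bsub>weyl_group A\<^esub> = word_class ?S ?R u" if "u \<in> gwords ?S" for u
    using that
  proof (induction u)
    case Nil
    then show ?case
      by (auto simp: weyl_group_def one_presented_group[OF R] intro!: exI[of _ "[]"])
  next
    case (Cons x u)
    then obtain xs where xs: "set xs \<subseteq> simple_reflection A ` ?S"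
      "foldr (\<otimes>\<^bsub>weyl_group A\<^esub>) xs \<one>\<^bsub>weyl_group A\<^esub> = word_class ?S ?R u" by auto
    obtain i b where x: "x = (i, b)" by (cases x)
    have "simple_reflection A i \<otimes>\<^bsub>weyl_group A\<^esub> word_class ?S ?R u = word_class ?S ?R (x # u)"
      using Cons.prems x mult_presented_group[OF R, of "[x]" u] gen[of i b]
      by (simp add: weyl_group_def)
    then show ?case
      using xs Cons.prems x by (intro exI[of _ "simple_reflection A i # xs"]) auto
  qed
  then show ?thesis
    using assms by (auto simp: weyl_group_def carrier_presented_group[OF R])
qed

lemma finite_weyl_length_eq: "finite {w \<in> carrier (weyl_group A). weyl_length A w = k}"
proof -
  let ?X = "simple_reflection A ` weyl_gens A"
  let ?f = "\<lambda>xs. foldr (\<otimes>\<^bsub>weyl_group A\<^esub>) xs \<one>\<^bsub>weyl_group A\<^esub>"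
  have "{w \<in> carrier (weyl_group A). weyl_length A w = k} \<subseteq>
      ?f ` {xs. set xs \<subseteq> ?X \<and> length xs = k}"
  proof clarify
    fix w assume w: "w \<in> carrier (weyl_group A)"
    have "\<exists>k xs. set xs \<subseteq> ?X \<and> length xs = k \<and> ?f xs = w"
      using weyl_group_generated[OF w] by blast
    from LeastI_ex[OF this]
    show "w \<in> ?f ` {xs. set xs \<subseteq> ?X \<and> length xs = weyl_length A w}"
      unfolding weyl_length_def word_length_def by blast
  qed
  moreover have "finite {xs. set xs \<subseteq> ?X \<and> length xs = k}"
    by (rule finite_lists_length_eq) (simp add: weyl_gens_def)
  ultimately show ?thesis by (meson finite_imageI finite_subset)
qed

end

theory Submission
  imports Defs
begin

text \<open>
  Write \<open>D(w)\<close> for the set of generators that shorten \<open>w\<close> when multiplied from the left, and let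
  \<open>P\<close> be the Poincare series. Since all \<open>a\<^sub>i\<^sub>j\<close> off the diagonal are nonzero, no two distinct
  generators commute, and this forces \<open>D(w)\<close> to have at most two elements
  (\<open>card_descents_le_2\<close>): if \<open>J \<subseteq> D(w)\<close>, then \<open>w\<close> has a reduced word that begins with any given
  reduced word over \<open>J\<close> (\<open>starts_with_reduced\<close>), so that their lengths are bounded by that of
  \<open>w\<close>; but three pairwise non-commuting generators generate an infinite group. Inclusion-exclusion
  over \<open>D(w)\<close>, with \<open>D(w) = {}\<close> only for the identity, therefore stops at pairs:
  the series \<open>1\<close> equals \<open>P\<close>, minus the sum over \<open>i\<close> of the series of the \<open>w\<close> with \<open>i \<in> D(w)\<close>, plus
  the sum over \<open>i > j\<close> of the series of the \<open>w\<close> with \<open>{i, j} \<subseteq> D(w)\<close>.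

  Each of these series is a multiple of \<open>P\<close>. For one generator, multiplication by \<open>s\<^sub>i\<close> gives the
  factor \<open>t / (1 + t)\<close> (\<open>vertex_gf\<close>). For two, let \<open>f\<^sub>k\<close> be the series of the \<open>w\<close> that begin with the
  alternating word \<open>iji\<dots>\<close> of \<open>k\<close> letters, and \<open>b\<close> the series of the \<open>w\<close> with \<open>{i, j} \<subseteq> D(w)\<close>.
  Removing the first letter gives \<open>f\<^sub>k\<^sub>+\<^sub>1 = t (f\<^sub>k - b)\<close> for \<open>1 \<le> k < m\<^sub>i\<^sub>j\<close>, and the braid relation
  gives \<open>f\<^sub>k = b\<close> for \<open>k = m\<^sub>i\<^sub>j\<close>; hence
  \<open>b = t\<^sup>m / ((1 + t) (1 + t + \<dots> + t\<^sup>m\<^sup>-\<^sup>1)) P\<close> with \<open>m = m\<^sub>i\<^sub>j\<close>, and \<open>b = 0\<close> if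
  \<open>m\<^sub>i\<^sub>j = \<infinity>\<close> (\<open>edge_gf\<close>). So \<open>P\<close> is the inverse of a series that depends only on \<open>n\<close> and on the
  multiset of the \<open>m\<^sub>i\<^sub>j\<close> with \<open>i > j\<close> (\<open>poincare_series_formula\<close>), which an exchange of two entries
  below a diagonal with constant entries above it does not change.

  Two facts about the group given by the presentation are needed. The exchange condition follows from
  Tits' parity argument: the set of reflections that occur an odd number of times along a word
  depends only on the group element (\<open>odd_refls_cong\<close>). Lower bounds, namely that \<open>s\<^sub>i s\<^sub>j\<close> has
  order exactly \<open>m\<^sub>i\<^sub>j\<close> and that a triangle generates an infinite group, come from the integral
  representation given by \<open>A\<close> itself (\<open>fire_cong\<close>).
\<close>

section \<open>Words in the simple reflections\<close>

locale weyl =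
  fixes A :: "int mat"
begin

sublocale group "weyl_group A"
  by (rule group_weyl_group)

abbreviation W :: "nat gword set set" where
  "W \<equiv> carrier (weyl_group A)"

abbreviation mult_W :: "nat gword set \<Rightarrow> nat gword set \<Rightarrow> nat gword set" (infixl "\<cdot>" 70) where
  "x \<cdot> y \<equiv> x \<otimes>\<^bsub>weyl_group A\<^esub> y"

abbreviation one_W :: "nat gword set" ("\<e>") where
  "\<e> \<equiv> \<one>\<^bsub>weyl_group A\<^esub>"

abbreviation inverse_W :: "nat gword set \<Rightarrow> nat gword set" where
  "inverse_W x \<equiv> inv\<^bsub>weyl_group A\<^esub> x"

abbreviation power_W :: "nat gword set \<Rightarrow> nat \<Rightarrow> nat gword set" (infixr "\<up>" 75) where
  "x \<up> k \<equiv> x [^]\<^bsub>weyl_group A\<^esub> k"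

abbreviation I :: "nat set" where
  "I \<equiv> weyl_gens A"

abbreviation s :: "nat \<Rightarrow> nat gword set" where
  "s \<equiv> simple_reflection A"

definition eval_word :: "nat list \<Rightarrow> nat gword set" where
  "eval_word xs = foldr (\<lambda>x y. x \<cdot> y) (map s xs) \<e>"

lemma eval_word_Nil [simp]: "eval_word [] = \<e>"
  by (simp add: eval_word_def)

lemma eval_word_Cons [simp]: "eval_word (i # xs) = s i \<cdot> eval_word xs"
  by (simp add: eval_word_def)

lemma s_closed [simp]: "i \<in> I \<Longrightarrow> s i \<in> W"
  by (auto simp: weyl_group_def simple_reflection_def presented_gen_def
      carrier_presented_group[OF weyl_relators_subset])

lemma eval_word_closed [simp]: "set xs \<subseteq> I \<Longrightarrow> eval_word xs \<in> W"
  by (induction xs) auto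

lemma eval_word_append [simp]:
  "set xs \<subseteq> I \<Longrightarrow> set ys \<subseteq> I \<Longrightarrow> eval_word (xs @ ys) = eval_word xs \<cdot> eval_word ys"
  by (induction xs) (auto simp: m_assoc)

lemma eval_word_alternating_pairs:
  "i \<in> I \<Longrightarrow> j \<in> I \<Longrightarrow> eval_word (concat (replicate m [i, j])) = (s i \<cdot> s j) \<up> m"
proof (induction m)
  case (Suc m)
  then show ?case
    using nat_pow_Suc2[of "s i \<cdot> s j" m] by (simp add: m_assoc)
qed simp

lemma set_alternating_pairs: "set (concat (replicate m [i, j])) \<subseteq> {i, j}"
  by auto

lemma in_gwords_iff: "u \<in> gwords I \<longleftrightarrow> set (map fst u) \<subseteq> I"
  by (induction u) auto

lemma eval_word_eq_word_class:
  assumes "set xs \<subseteq> I"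
  shows "eval_word xs = word_class I (weyl_relators A) (map (\<lambda>i. (i, True)) xs)"
  using assms
proof (induction xs)
  case Nil
  then show ?case
    by (simp add: weyl_group_def one_presented_group[OF weyl_relators_subset])
next
  case (Cons i xs)
  then show ?case
    using mult_presented_group[OF weyl_relators_subset, of "[(i, True)]" A "map (\<lambda>i. (i, True)) xs"]
    by (auto simp: weyl_group_def simple_reflection_def presented_gen_def in_gwords_iff comp_def)
qed

lemma eval_word_eq_iff:
  assumes "set xs \<subseteq> I" "set ys \<subseteq> I"
  shows "eval_word xs = eval_word ys \<longleftrightarrow>
    (map (\<lambda>i. (i, True)) xs, map (\<lambda>i. (i, True)) ys) \<in> presentation_rel I (weyl_relators A)"
  using assms
  by (simp add: eval_word_eq_word_class in_gwords_iff comp_def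
      word_class_eq_iff[OF weyl_relators_subset])

text \<open>
  The universal property of the presentation, in the form in which it is used below: a quantity
  attached to words depends only on the group element as soon as inserting a defining relator
  does not change it.
\<close>

lemma word_invariant:
  assumes xs: "set xs \<subseteq> I" and ys: "set ys \<subseteq> I" and eq: "eval_word xs = eval_word ys"
    and square: "\<And>u v i. set u \<subseteq> I \<Longrightarrow> set v \<subseteq> I \<Longrightarrow> i \<in> I \<Longrightarrow> \<phi> (u @ [i, i] @ v) = \<phi> (u @ v)"
    and braid: "\<And>u v i j m. set u \<subseteq> I \<Longrightarrow> set v \<subseteq> I \<Longrightarrow> i \<in> I \<Longrightarrow> j \<in> I \<Longrightarrow> i \<noteq> j \<Longrightarrow>
      coxeter_exponent A i j = enat m \<Longrightarrow> \<phi> (u @ concat (replicate m [i, j]) @ v) = \<phi> (u @ v)"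
  shows "\<phi> xs = \<phi> ys"
proof -
  have "\<phi> (map fst u) = \<phi> (map fst v)" if "(u, v) \<in> presentation_rel I (weyl_relators A)" for u v
    using that
  proof (induction rule: presentation_rel.induct)
    case (cancel u v i b)
    then show ?case
      using square[of "map fst u" "map fst v" i] by (simp add: in_gwords_iff)
  next
    case (relator u v r)
    have pairs: "map fst (concat (replicate m [(i, True), (j, True)])) = concat (replicate m [i, j])"
      for i j :: nat and m by (induction m) auto
    from relator(3) show ?case
      unfolding weyl_relators_def
    proof (elim UnE CollectE exE conjE)
      fix i assume "r = [(i, True), (i, True)]" "i \<in> I"
      then show ?thesis
        using relator square[of "map fst u" "map fst v" i] by (simp add: in_gwords_iff)
    next
      fix i j m
      assume "r = concat (replicate m [(i, True), (j, True)])" "i \<in> I" "j \<in> I" "i \<noteq> j"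
        "coxeter_exponent A i j = enat m"
      then show ?thesis
        using relator braid[of "map fst u" "map fst v" i j m] by (simp add: in_gwords_iff pairs)
    qed
  qed auto
  from this[OF iffD1[OF eval_word_eq_iff[OF xs ys] eq]] show ?thesis
    by (simp add: comp_def)
qed

lemma eval_relator:
  assumes "map (\<lambda>i. (i, True)) r \<in> weyl_relators A"
  shows "eval_word r = \<e>"
proof -
  have r: "set r \<subseteq> I"
    using assms weyl_relators_subset[of A] by (force simp: in_gwords_iff)
  have "([] @ map (\<lambda>i. (i, True)) r @ [], [] @ []) \<in> presentation_rel I (weyl_relators A)"
    using assms by (intro presentation_rel.relator) auto
  then show ?thesis
    using eval_word_eq_iff[of r "[]"] r by simp
qed

lemma s_squared [simp]: "i \<in> I \<Longrightarrow> s i \<cdot> s i = \<e>"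
  using eval_relator[of "[i, i]"] by (auto simp: weyl_relators_def)

lemma s_cancel [simp]: "i \<in> I \<Longrightarrow> w \<in> W \<Longrightarrow> s i \<cdot> (s i \<cdot> w) = w"
  by (metis l_one m_assoc s_closed s_squared)

lemma inv_s [simp]: "i \<in> I \<Longrightarrow> inverse_W (s i) = s i"
  by (simp add: inv_equality)

lemma s_power_exponent:
  assumes "i \<in> I" "j \<in> I" "i \<noteq> j" "coxeter_exponent A i j = enat m"
  shows "(s i \<cdot> s j) \<up> m = \<e>"
proof -
  have "map (\<lambda>i. (i, True)) (concat (replicate m [i, j])) \<in> weyl_relators A"
    using assms by (auto simp: weyl_relators_def map_concat)
  from eval_relator[OF this] show ?thesis
    using assms by (simp add: eval_word_alternating_pairs)
qed

lemma word_exists: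
  assumes "w \<in> W"
  obtains xs where "set xs \<subseteq> I" "eval_word xs = w"
proof -
  obtain ys where ys: "set ys \<subseteq> s ` I" "foldr (\<lambda>x y. x \<cdot> y) ys \<e> = w"
    using weyl_group_generated[OF assms] by blast
  then have "ys \<in> map s ` lists I"
    unfolding lists_image[symmetric] by auto
  then obtain xs where "ys = map s xs" "set xs \<subseteq> I"
    by auto
  then show thesis
    using that ys by (simp add: eval_word_def)
qed

section \<open>Length and reflections of a word\<close>

abbreviation len :: "nat gword set \<Rightarrow> nat" where
  "len \<equiv> weyl_length A"

lemma len_eq_Least: "len w = (LEAST k. \<exists>xs. set xs \<subseteq> I \<and> length xs = k \<and> eval_word xs = w)"
proof -
  have "(\<exists>ys. set ys \<subseteq> s ` I \<and> length ys = k \<and> foldr (\<lambda>x y. x \<cdot> y) ys \<e> = w) \<longleftrightarrow>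
      (\<exists>xs. set xs \<subseteq> I \<and> length xs = k \<and> eval_word xs = w)" for k
  proof
    assume "\<exists>ys. set ys \<subseteq> s ` I \<and> length ys = k \<and> foldr (\<lambda>x y. x \<cdot> y) ys \<e> = w"
    then obtain ys where ys: "ys \<in> lists (s ` I)" "length ys = k" "foldr (\<lambda>x y. x \<cdot> y) ys \<e> = w"
      by auto
    then obtain xs where "ys = map s xs" "set xs \<subseteq> I"
      unfolding lists_image by auto
    then show "\<exists>xs. set xs \<subseteq> I \<and> length xs = k \<and> eval_word xs = w"
      using ys by (auto simp: eval_word_def)
  next
    assume "\<exists>xs. set xs \<subseteq> I \<and> length xs = k \<and> eval_word xs = w"
    then obtain xs where "set xs \<subseteq> I" "length xs = k" "eval_word xs = w" by blast
    then show "\<exists>ys. set ys \<subseteq> s ` I \<and> length ys = k \<and> foldr (\<lambda>x y. x \<cdot> y) ys \<e> = w"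
      by (intro exI[of _ "map s xs"]) (auto simp: eval_word_def)
  qed
  then show ?thesis
    by (simp add: weyl_length_def word_length_def)
qed

lemma len_le_length: "set xs \<subseteq> I \<Longrightarrow> len (eval_word xs) \<le> length xs"
  unfolding len_eq_Least by (rule Least_le) auto

definition reduced :: "nat list \<Rightarrow> bool" where
  "reduced xs \<longleftrightarrow> set xs \<subseteq> I \<and> len (eval_word xs) = length xs"

lemma reduced_word_exists:
  assumes "w \<in> W"
  obtains xs where "reduced xs" "eval_word xs = w"
proof -
  obtain ys where "set ys \<subseteq> I" "eval_word ys = w"
    using word_exists[OF assms] .
  then have "\<exists>k xs. set xs \<subseteq> I \<and> length xs = k \<and> eval_word xs = w"
    by blast
  from LeastI_ex[OF this] have "\<exists>xs. set xs \<subseteq> I \<and> length xs = len w \<and> eval_word xs = w"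
    by (simp only: len_eq_Least)
  then obtain xs where "set xs \<subseteq> I" "length xs = len w" "eval_word xs = w"
    by (elim exE conjE)
  then have "reduced xs" "eval_word xs = w"
    by (auto simp: reduced_def)
  then show thesis
    by (rule that)
qed

lemma len_mult_le:
  assumes "set xs \<subseteq> I" "w \<in> W"
  shows "len (eval_word xs \<cdot> w) \<le> length xs + len w"
proof -
  obtain ys where "reduced ys" "eval_word ys = w"
    using reduced_word_exists[OF assms(2)] .
  then show ?thesis
    using len_le_length[of "xs @ ys"] assms by (auto simp: reduced_def)
qed

lemma len_one [simp]: "len \<e> = 0"
  using len_le_length[of "[]"] by simp

lemma reduced_ConsD: "reduced (i # xs) \<Longrightarrow> reduced xs"
  using len_mult_le[of "[i]" "eval_word xs"] len_le_length[of xs] by (auto simp: reduced_def)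

text \<open>
  The \<open>k\<close>-th entry of \<open>refls xs\<close> is the reflection whose left multiplication deletes the
  \<open>k\<close>-th letter of \<open>xs\<close>.
\<close>

primrec refls :: "nat list \<Rightarrow> nat gword set list" where
  "refls [] = []"
| "refls (i # xs) = s i # map (\<lambda>t. s i \<cdot> t \<cdot> s i) (refls xs)"

lemma length_refls [simp]: "length (refls xs) = length xs"
  by (induction xs) auto

lemma refls_closed: "set xs \<subseteq> I \<Longrightarrow> set (refls xs) \<subseteq> W"
  by (induction xs) auto

lemma refls_append:
  assumes "set u \<subseteq> I" "set v \<subseteq> I"
  shows "refls (u @ v) = refls u @ map (\<lambda>t. eval_word u \<cdot> t \<cdot> inverse_W (eval_word u)) (refls v)"
  using assms refls_closed[of v]
  by (induction u) (auto simp: m_assoc inv_mult_group intro!: map_cong map_idI[symmetric])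

definition odd_refls :: "nat list \<Rightarrow> nat gword set set" where
  "odd_refls xs = {t. odd (count_list (refls xs) t)}"

lemma odd_refls_subset: "odd_refls xs \<subseteq> set (refls xs)"
  by (auto simp: odd_refls_def intro: ccontr)

text \<open>
  A relator contributes each conjugate of an entry of \<open>l\<close> twice and, being trivial in the group,
  leaves the reflections of the remaining letters as they are.
\<close>

lemma odd_refls_insert_relator:
  assumes "set u \<subseteq> I" "set r \<subseteq> I" "set v \<subseteq> I"
    and r: "eval_word r = \<e>" "refls r = l @ l"
  shows "odd_refls (u @ r @ v) = odd_refls (u @ v)"
proof -
  have "refls (r @ v) = l @ l @ refls v"
    using assms refls_closed[of v] by (auto simp: refls_append intro!: map_idI)
  then show ?thesis
    using assms by (auto simp: refls_append odd_refls_def)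
qed

end

section \<open>Alternating words and the parity of reflections\<close>

primrec alt :: "'a \<Rightarrow> 'a \<Rightarrow> nat \<Rightarrow> 'a list" where
  "alt i j 0 = []"
| "alt i j (Suc k) = i # alt j i k"

lemma length_alt [simp]: "length (alt i j k) = k"
  by (induction k arbitrary: i j) auto

lemma set_alt_subset: "set (alt i j k) \<subseteq> {i, j}"
  by (induction k arbitrary: i j) auto

lemma alt_double: "alt i j (2 * m) = concat (replicate m [i, j])"
  by (induction m) auto

lemma count_list_distinct: "distinct xs \<Longrightarrow> count_list xs x = of_bool (x \<in> set xs)"
  by (induction xs) auto

context weyl
begin

lemma set_alt_I: "i \<in> I \<Longrightarrow> j \<in> I \<Longrightarrow> set (alt i j k) \<subseteq> I"
  using set_alt_subset[of i j k] by auto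

lemma s_power_shift:
  assumes "i \<in> I" "j \<in> I"
  shows "s i \<cdot> (s j \<cdot> s i) \<up> k = (s i \<cdot> s j) \<up> k \<cdot> s i"
proof (induction k)
  case (Suc k)
  have "s i \<cdot> (s j \<cdot> s i) \<up> Suc k = (s i \<cdot> (s j \<cdot> s i) \<up> k) \<cdot> (s j \<cdot> s i)"
    using assms by (simp add: m_assoc)
  also have "\<dots> = ((s i \<cdot> s j) \<up> k \<cdot> s i) \<cdot> (s j \<cdot> s i)"
    by (simp only: Suc)
  also have "\<dots> = (s i \<cdot> s j) \<up> Suc k \<cdot> s i"
    using assms by (simp add: m_assoc)
  finally show ?case .
qed (use assms in simp)

lemma refls_alt:
  assumes "i \<in> I" "j \<in> I"
  shows "refls (alt i j k) = map (\<lambda>p. (s i \<cdot> s j) \<up> p \<cdot> s i) [0..<k]"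
  using assms
proof (induction k arbitrary: i j)
  case (Suc k)
  have "s i \<cdot> ((s j \<cdot> s i) \<up> p \<cdot> s j) \<cdot> s i = (s i \<cdot> s j) \<up> Suc p \<cdot> s i" for p
  proof -
    have "s i \<cdot> ((s j \<cdot> s i) \<up> p \<cdot> s j) \<cdot> s i = (s i \<cdot> (s j \<cdot> s i) \<up> p) \<cdot> (s j \<cdot> s i)"
      using Suc.prems by (simp add: m_assoc)
    also have "\<dots> = (s i \<cdot> s j) \<up> Suc p \<cdot> s i"
      using Suc.prems by (simp add: s_power_shift m_assoc)
    finally show ?thesis .
  qed
  then have "refls (alt i j (Suc k)) = s i # map (\<lambda>p. (s i \<cdot> s j) \<up> Suc p \<cdot> s i) [0..<k]"
    using Suc by (simp add: comp_def)
  also have "\<dots> = map (\<lambda>p. (s i \<cdot> s j) \<up> p \<cdot> s i) [0..<Suc k]"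
    unfolding map_upt_Suc using Suc.prems by simp
  finally show ?case .
qed simp

text \<open>
  At the exponent of the pair the power disappears, and what remains is the braid relation in its
  symmetric form.
\<close>

lemma eval_alt_swap:
  assumes "i \<in> I" "j \<in> I"
  shows "eval_word (alt i j k) = (s i \<cdot> s j) \<up> k \<cdot> eval_word (alt j i k)"
  using assms
proof (induction k arbitrary: i j)
  case (Suc k)
  note [simp] = Suc.prems set_alt_I
  have "eval_word (alt i j (Suc k)) = s i \<cdot> (s j \<cdot> s i) \<up> k \<cdot> eval_word (alt i j k)"
    using Suc.IH[of j i] by (simp add: m_assoc)
  also have "\<dots> = (s i \<cdot> s j) \<up> k \<cdot> s i \<cdot> (s j \<cdot> (s j \<cdot> eval_word (alt i j k)))"
    by (simp add: s_power_shift)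
  also have "\<dots> = (s i \<cdot> s j) \<up> Suc k \<cdot> eval_word (alt j i (Suc k))"
    by (simp add: m_assoc del: s_cancel)
  finally show ?case .
qed simp

lemma eval_alt_swap_exponent:
  assumes "i \<in> I" "j \<in> I" "i \<noteq> j" "coxeter_exponent A i j = enat m"
  shows "eval_word (alt i j m) = eval_word (alt j i m)"
  using eval_alt_swap[of i j m] s_power_exponent[OF assms] assms by (simp add: set_alt_I)

text \<open>
  The reflections along an alternating word are \<open>(s\<^sub>i s\<^sub>j)\<^sup>p s\<^sub>i\<close>, which is periodic in \<open>p\<close> with
  period \<open>m\<close>; a braid relator has \<open>2 m\<close> letters and so runs through two periods.
\<close>

lemma refls_braid:
  assumes "i \<in> I" "j \<in> I" "i \<noteq> j" "coxeter_exponent A i j = enat m"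
  shows "\<exists>l. refls (concat (replicate m [i, j])) = l @ l"
proof -
  let ?r = "\<lambda>p. (s i \<cdot> s j) \<up> p \<cdot> s i"
  have period: "?r (p + m) = ?r p" for p
  proof -
    have "(s i \<cdot> s j) \<up> (p + m) = (s i \<cdot> s j) \<up> p \<cdot> (s i \<cdot> s j) \<up> m"
      using assms by (simp add: nat_pow_mult)
    then show ?thesis
      using assms s_power_exponent[OF assms] by simp
  qed
  have "[0..<2 * m] = [0..<m] @ map (\<lambda>p. p + m) [0..<m]"
    using upt_add_eq_append[of 0 m m] by (simp add: mult_2 map_add_upt)
  then have "refls (alt i j (2 * m)) = map ?r [0..<m] @ map ?r [0..<m]"
    using assms period by (simp add: refls_alt comp_def)
  then show ?thesis
    unfolding alt_double by blast
qed

text \<open>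
  Tits' parity argument: along each defining relator, every reflection occurs an even number of
  times.
\<close>

lemma odd_refls_cong:
  assumes "set xs \<subseteq> I" "set ys \<subseteq> I" "eval_word xs = eval_word ys"
  shows "odd_refls xs = odd_refls ys"
proof (rule word_invariant[where \<phi> = odd_refls, OF assms])
  fix u v i
  assume "set u \<subseteq> I" "set v \<subseteq> I" "i \<in> I"
  then show "odd_refls (u @ [i, i] @ v) = odd_refls (u @ v)"
    by (intro odd_refls_insert_relator[where l = "[s i]"]) auto
next
  fix u v i j m
  assume *: "set u \<subseteq> I" "set v \<subseteq> I" "i \<in> I" "j \<in> I" "i \<noteq> j" "coxeter_exponent A i j = enat m"
  obtain l where "refls (concat (replicate m [i, j])) = l @ l"
    using refls_braid *(3-6) by blast
  then show "odd_refls (u @ concat (replicate m [i, j]) @ v) = odd_refls (u @ v)"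
    using * set_alternating_pairs[of m i j]
    by (intro odd_refls_insert_relator[where l = l])
      (auto simp: eval_word_alternating_pairs s_power_exponent simp del: set_concat)
qed

text \<open>
  A reflection that occurs exactly once along one word of \<open>w\<close> occurs along every word of \<open>w\<close>, so
  that no word of \<open>w\<close> can be shorter than the number of these reflections.
\<close>

lemma reduced_if_distinct_refls:
  assumes "set xs \<subseteq> I" "distinct (refls xs)"
  shows "reduced xs"
proof -
  obtain ys where ys: "reduced ys" "eval_word ys = eval_word xs"
    using reduced_word_exists[of "eval_word xs"] assms by auto
  have "odd_refls xs = set (refls xs)"
    using count_list_distinct[OF assms(2)] by (simp add: odd_refls_def)
  then have "length xs = card (odd_refls ys)"
    using odd_refls_cong[of xs ys] ys assms distinct_card[OF assms(2)] by (simp add: reduced_def)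
  also have "\<dots> \<le> card (set (refls ys))"
    by (rule card_mono[OF _ odd_refls_subset]) simp
  also have "\<dots> \<le> length ys"
    using card_length[of "refls ys"] by simp
  finally show ?thesis
    using ys len_le_length[of xs] assms by (simp add: reduced_def)
qed

lemma refls_deletion:
  assumes "set xs \<subseteq> I" "t \<in> set (refls xs)"
  shows "\<exists>u k v. xs = u @ k # v \<and> t \<cdot> eval_word xs = eval_word (u @ v)"
  using assms
proof (induction xs arbitrary: t)
  case (Cons i xs)
  show ?case
  proof (cases "t = s i")
    case True
    then show ?thesis
      using Cons.prems by (intro exI[of _ "[]"]) auto
  next
    case False
    then obtain r where r: "r \<in> set (refls xs)" "t = s i \<cdot> r \<cdot> s i"
      using Cons.prems by auto
    then have "r \<in> W"
      using refls_closed[of xs] Cons.prems by auto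
    obtain u k v where "xs = u @ k # v" "r \<cdot> eval_word xs = eval_word (u @ v)"
      using Cons.IH[OF _ r(1)] Cons.prems by auto
    moreover have "t \<cdot> eval_word (i # xs) = s i \<cdot> (r \<cdot> eval_word xs)"
      using Cons.prems r \<open>r \<in> W\<close> by (simp add: m_assoc)
    ultimately show ?thesis
      using Cons.prems by (intro exI[of _ "i # u"] exI[of _ k] exI[of _ v]) auto
  qed
qed simp

section \<open>Descents and the exchange condition\<close>

definition descents :: "nat gword set \<Rightarrow> nat set" where
  "descents w = {i \<in> I. len (s i \<cdot> w) < len w}"

lemma len_less_if_odd_refls:
  assumes "set xs \<subseteq> I" "t \<in> odd_refls xs"
  shows "len (t \<cdot> eval_word xs) < len (eval_word xs)"
proof -
  obtain ys where ys: "reduced ys" "eval_word ys = eval_word xs"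
    using reduced_word_exists[of "eval_word xs"] assms by auto
  then have "t \<in> set (refls ys)"
    using odd_refls_cong[of xs ys] assms odd_refls_subset[of ys] by (auto simp: reduced_def)
  then obtain u k v where uv: "ys = u @ k # v" "t \<cdot> eval_word ys = eval_word (u @ v)"
    using refls_deletion[of ys t] ys by (auto simp: reduced_def)
  then have "len (t \<cdot> eval_word xs) \<le> length (u @ v)"
    using ys len_le_length[of "u @ v"] by (auto simp: reduced_def)
  moreover have "len (eval_word xs) = length ys"
    using ys(1) unfolding ys(2)[symmetric] by (simp add: reduced_def)
  ultimately show ?thesis
    using uv(1) by simp
qed

lemma s_in_odd_refls_Cons_iff:
  assumes "i \<in> I" "set xs \<subseteq> I"
  shows "s i \<in> odd_refls (i # xs) \<longleftrightarrow> s i \<notin> odd_refls xs"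
proof -
  have "s i \<cdot> t \<cdot> s i = s i \<longleftrightarrow> t = s i" if "t \<in> W" for t
    using that assms by (metis m_closed r_cancel_one s_cancel s_closed s_squared)
  then have "count_list (map (\<lambda>t. s i \<cdot> t \<cdot> s i) ts) (s i) = count_list ts (s i)"
    if "set ts \<subseteq> W" for ts
    using that by (induction ts) auto
  then show ?thesis
    using refls_closed[OF assms(2)] by (auto simp: odd_refls_def)
qed

text \<open>
  Exactly one of \<open>w\<close> and \<open>s\<^sub>i w\<close> has \<open>s\<^sub>i\<close> among its odd reflections, and an odd reflection
  shortens. This rules out equal lengths.
\<close>

lemma len_s_mult_if_not_descent:
  assumes "i \<in> I" "w \<in> W" "i \<notin> descents w"
  shows "len (s i \<cdot> w) = Suc (len w)"
proof -
  obtain xs where xs: "reduced xs" "eval_word xs = w"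
    using reduced_word_exists[OF assms(2)] .
  then have "s i \<notin> odd_refls xs"
    using len_less_if_odd_refls[of xs "s i"] assms by (auto simp: reduced_def descents_def)
  then have "s i \<in> odd_refls (i # xs)"
    using s_in_odd_refls_Cons_iff[of i xs] assms xs by (auto simp: reduced_def)
  then have "len (s i \<cdot> eval_word (i # xs)) < len (eval_word (i # xs))"
    using assms xs by (intro len_less_if_odd_refls) (auto simp: reduced_def)
  then show ?thesis
    using assms xs len_mult_le[of "[i]" w] by (simp add: reduced_def)
qed

lemma len_s_mult_if_descent:
  assumes "i \<in> descents w" "w \<in> W"
  shows "Suc (len (s i \<cdot> w)) = len w"
  using assms len_mult_le[of "[i]" "s i \<cdot> w"] by (auto simp: descents_def)

lemma s_mult_descents_iff:
  assumes "i \<in> I" "w \<in> W"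
  shows "i \<in> descents (s i \<cdot> w) \<longleftrightarrow> i \<notin> descents w"
  using assms len_s_mult_if_not_descent[of i w] len_s_mult_if_descent[of i w]
  by (auto simp: descents_def)

lemma exchange:
  assumes "set xs \<subseteq> I" "i \<in> descents (eval_word xs)"
  shows "\<exists>u k v. xs = u @ k # v \<and> s i \<cdot> eval_word xs = eval_word (u @ v)"
proof -
  have i: "i \<in> I"
    using assms by (auto simp: descents_def)
  have "s i \<in> odd_refls xs"
  proof (rule ccontr)
    assume "s i \<notin> odd_refls xs"
    then have "s i \<in> odd_refls (i # xs)"
      using s_in_odd_refls_Cons_iff[of i xs] assms i by simp
    then have "len (s i \<cdot> eval_word (i # xs)) < len (eval_word (i # xs))"
      using assms i by (intro len_less_if_odd_refls) auto
    then show False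
      using assms i by (simp add: descents_def)
  qed
  then show ?thesis
    using refls_deletion[of xs "s i"] odd_refls_subset[of xs] assms by auto
qed

text \<open>
  The exchange condition only ever deletes letters, so that a parabolic subgroup contains a reduced
  word, over its own generators, of each of its elements.
\<close>

lemma reduced_subword_exists:
  assumes "set xs \<subseteq> I"
  shows "\<exists>ys. reduced ys \<and> set ys \<subseteq> set xs \<and> eval_word ys = eval_word xs"
  using assms
proof (induction xs)
  case Nil
  show ?case by (simp add: reduced_def)
next
  case (Cons i xs)
  then obtain ys where ys: "reduced ys" "set ys \<subseteq> set xs" "eval_word ys = eval_word xs"
    by auto
  then have ys_I: "set ys \<subseteq> I" and i: "i \<in> I"
    using Cons.prems by auto
  have len_ys: "len (eval_word ys) = length ys"
    using ys(1) by (simp add: reduced_def)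
  show ?case
  proof (cases "i \<in> descents (eval_word ys)")
    case True
    then obtain u k v where uv: "ys = u @ k # v" "s i \<cdot> eval_word ys = eval_word (u @ v)"
      using exchange[OF ys_I] by blast
    then have "Suc (len (eval_word (u @ v))) = length ys"
      using len_s_mult_if_descent[OF True] len_ys eval_word_closed[OF ys_I] by simp
    then have "reduced (u @ v)" "set (u @ v) \<subseteq> set (i # xs)"
      using uv ys ys_I by (auto simp: reduced_def)
    then show ?thesis
      using uv ys by (intro exI[of _ "u @ v"]) simp
  next
    case False
    then have "reduced (i # ys)"
      using len_s_mult_if_not_descent[OF i eval_word_closed[OF ys_I] False] len_ys ys_I i
      by (simp add: reduced_def)
    then show ?thesis
      using ys by (intro exI[of _ "i # ys"]) auto
  qed
qed

text \<open>
  Some reduced word of \<open>w\<close> begins with \<open>xs\<close>. In terms of lengths, this depends on \<open>xs\<close> only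
  through its group element and its number of letters, which lets braid relations act on it.
\<close>

definition starts_with :: "nat list \<Rightarrow> nat gword set \<Rightarrow> bool" where
  "starts_with xs w \<longleftrightarrow> (\<exists>u \<in> W. w = eval_word xs \<cdot> u \<and> len w = length xs + len u)"

lemma starts_with_Nil [simp]: "w \<in> W \<Longrightarrow> starts_with [] w"
  by (auto simp: starts_with_def)

lemma starts_with_Cons_iff:
  assumes "i \<in> I" "set xs \<subseteq> I" "w \<in> W"
  shows "starts_with (i # xs) w \<longleftrightarrow> i \<in> descents w \<and> starts_with xs (s i \<cdot> w)"
proof
  assume "starts_with (i # xs) w"
  then obtain u where u: "u \<in> W" "w = s i \<cdot> eval_word xs \<cdot> u" "len w = Suc (length xs + len u)"
    by (auto simp: starts_with_def)
  then have sw: "s i \<cdot> w = eval_word xs \<cdot> u"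
    using assms by (simp add: m_assoc)
  then have "len (s i \<cdot> w) \<le> length xs + len u"
    using len_mult_le assms u by simp
  then have "i \<in> descents w"
    using assms u by (auto simp: descents_def)
  then show "i \<in> descents w \<and> starts_with xs (s i \<cdot> w)"
    using u sw len_s_mult_if_descent[of i w] assms by (auto simp: starts_with_def)
next
  assume *: "i \<in> descents w \<and> starts_with xs (s i \<cdot> w)"
  then obtain u where u: "u \<in> W" "s i \<cdot> w = eval_word xs \<cdot> u" "len (s i \<cdot> w) = length xs + len u"
    by (auto simp: starts_with_def)
  then have "w = eval_word (i # xs) \<cdot> u"
    using assms by (metis eval_word_Cons eval_word_closed m_assoc s_cancel s_closed)
  then show "starts_with (i # xs) w"
    using * u len_s_mult_if_descent[of i w] assms by (auto simp: starts_with_def)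
qed

text \<open>
  If all of \<open>J\<close> are descents, then \<open>w\<close> behaves as if it began with a longest element of the subgroup
  generated by \<open>J\<close>. Build the reduced word over \<open>J\<close> from its end: with \<open>w = xs u\<close> already known,
  the exchange condition for a descent \<open>i\<close> deletes a letter either from \<open>xs\<close>, which is impossible
  if \<open>i # xs\<close> is reduced, or from \<open>u\<close>, which moves \<open>i\<close> to the front of \<open>xs\<close>.
\<close>

lemma starts_with_reduced:
  assumes "w \<in> W" "J \<subseteq> descents w" "reduced xs" "set xs \<subseteq> J"
  shows "starts_with xs w"
  using assms(3,4)
proof (induction xs)
  case Nil
  then show ?case using assms by simp
next
  case (Cons i xs)
  have xs: "reduced xs" "set xs \<subseteq> I" and i: "i \<in> I" "i \<in> descents w"
    using Cons.prems reduced_ConsD assms by (auto simp: reduced_def)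
  then obtain u where u: "u \<in> W" "w = eval_word xs \<cdot> u" "len w = length xs + len u"
    using Cons by (auto simp: starts_with_def)
  obtain zs where zs: "reduced zs" "eval_word zs = u"
    using reduced_word_exists[OF u(1)] .
  then have zs_I: "set zs \<subseteq> I" "len u = length zs"
    by (auto simp: reduced_def)
  have "i \<in> descents (eval_word (xs @ zs))"
    using i u xs zs zs_I by simp
  from exchange[OF _ this] obtain a k b
    where ab: "xs @ zs = a @ k # b" "s i \<cdot> w = eval_word (a @ b)"
    using u xs zs zs_I by auto
  from ab(1) consider c where "xs = a @ k # c" "b = c @ zs" | c where "a = xs @ c" "zs = c @ k # b"
    by (auto simp: append_eq_append_conv2 append_eq_Cons_conv Cons_eq_append_conv)
  then show ?case
  proof cases
    case 1
    then have I: "set a \<subseteq> I" "set c \<subseteq> I"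
      using xs by auto
    have "eval_word (i # xs) \<cdot> u = eval_word (a @ c) \<cdot> u"
      using ab(2) 1 u xs i zs zs_I I by (simp add: m_assoc)
    then have "eval_word (i # xs) = eval_word (a @ c)"
      using I i xs u by (simp add: right_cancel)
    then have "len (eval_word (i # xs)) \<le> length (a @ c)"
      using len_le_length[of "a @ c"] I by simp
    then show ?thesis
      using Cons.prems 1 by (simp add: reduced_def)
  next
    case 2
    then have I: "set c \<subseteq> I" "set b \<subseteq> I"
      using zs_I by auto
    have sw: "s i \<cdot> w = eval_word xs \<cdot> eval_word (c @ b)"
      using ab(2) 2 I xs by (simp add: m_assoc)
    then have w: "w = eval_word (i # xs) \<cdot> eval_word (c @ b)"
      using I i xs assms by (metis eval_word_Cons eval_word_append eval_word_closed m_assoc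
          m_closed s_cancel s_closed)
    have "len w \<le> length (i # xs) + len (eval_word (c @ b))"
      unfolding w using i xs I by (intro len_mult_le) auto
    moreover have "len (eval_word (c @ b)) \<le> length (c @ b)"
      using len_le_length[of "c @ b"] I by simp
    ultimately have "len w = length (i # xs) + len (eval_word (c @ b))"
      using u zs_I 2 by simp
    then show ?thesis
      using w I unfolding starts_with_def by (intro bexI[of _ "eval_word (c @ b)"]) auto
  qed
qed

end

section \<open>The integral representation of the Weyl group\<close>

locale weyl_of_cartan = weyl A for A :: "int mat" +
  fixes n :: nat
  assumes cartan: "cartan_matrix n A"
begin

lemma I_eq: "I = {..<n}"
  using cartan by (auto simp: cartan_matrix_def weyl_gens_def)

lemma diagonal [simp]: "i \<in> I \<Longrightarrow> A $$ (i, i) = 2"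
  using cartan by (auto simp: cartan_matrix_def I_eq)

lemma off_diagonal: "i \<in> I \<Longrightarrow> j \<in> I \<Longrightarrow> i \<noteq> j \<Longrightarrow> A $$ (i, j) \<le> 0"
  using cartan by (auto simp: cartan_matrix_def I_eq)

lemma off_diagonal_zero: "i \<in> I \<Longrightarrow> j \<in> I \<Longrightarrow> A $$ (i, j) = 0 \<Longrightarrow> A $$ (j, i) = 0"
  using cartan unfolding cartan_matrix_def I_eq by blast

text \<open>
  The action dual to \<open>s\<^sub>i \<alpha>\<^sub>k = \<alpha>\<^sub>k - a\<^sub>i\<^sub>k \<alpha>\<^sub>i\<close> on the root lattice: \<open>x k\<close> is the value of a linear
  form at \<open>\<alpha>\<^sub>k\<close>. This is also a move of the numbers game, in which node \<open>i\<close> changes its sign and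
  passes multiples of its value on to the other nodes.
\<close>

definition fire :: "nat \<Rightarrow> (nat \<Rightarrow> int) \<Rightarrow> nat \<Rightarrow> int" where
  "fire i x = (\<lambda>k. x k - A $$ (i, k) * x i)"

text \<open>
  Two generators \<open>i\<close> and \<open>j\<close> change \<open>x\<close> only by multiples of the rows \<open>i\<close> and \<open>j\<close> of \<open>A\<close>. With these
  multiples \<open>p\<close> and \<open>q\<close> as coordinates, an alternating product becomes a short computation with
  linear expressions in \<open>x i\<close> and \<open>x j\<close>.
\<close>

definition shift :: "nat \<Rightarrow> nat \<Rightarrow> (nat \<Rightarrow> int) \<Rightarrow> int \<Rightarrow> int \<Rightarrow> nat \<Rightarrow> int" where
  "shift i j x p q = (\<lambda>k. x k - A $$ (i, k) * p - A $$ (j, k) * q)"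

lemma shift_0 [simp]: "shift i j x 0 0 = x"
  by (simp add: shift_def)

lemma fire_shift:
  assumes "i \<in> I" "j \<in> I"
  shows "fire i (shift i j x p q) = shift i j x (x i - p - A $$ (j, i) * q) q"
    and "fire j (shift i j x p q) = shift i j x p (x j - q - A $$ (i, j) * p)"
  using assms by (auto simp: fire_def shift_def fun_eq_iff algebra_simps)

lemma shift_neq:
  assumes "i \<in> I" "j \<in> I" "2 * p + A $$ (j, i) * q \<noteq> 0 \<or> A $$ (i, j) * p + 2 * q \<noteq> 0"
  shows "shift i j x p q \<noteq> x"
proof
  assume "shift i j x p q = x"
  then have "shift i j x p q i = x i" "shift i j x p q j = x j"
    by simp_all
  then show False
    using assms by (auto simp: shift_def algebra_simps)
qed

lemma fire_fire: "i \<in> I \<Longrightarrow> fire i (fire i x) = x"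
  by (auto simp: fire_def fun_eq_iff algebra_simps)

lemma finite_exponent_cases:
  assumes "i \<in> I" "j \<in> I" "i \<noteq> j" "coxeter_exponent A i j = enat m"
  obtains "m = 2" "A $$ (i, j) = 0" "A $$ (j, i) = 0"
  | "m = 3" "A $$ (i, j) = -1" "A $$ (j, i) = -1"
  | "m = 4" "A $$ (i, j) = -1" "A $$ (j, i) = -2"
  | "m = 4" "A $$ (i, j) = -2" "A $$ (j, i) = -1"
  | "m = 6" "A $$ (i, j) = -1" "A $$ (j, i) = -3"
  | "m = 6" "A $$ (i, j) = -3" "A $$ (j, i) = -1"
proof -
  obtain a b :: int where ab: "A $$ (i, j) = -a" "A $$ (j, i) = -b" "a \<ge> 0" "b \<ge> 0"
    using off_diagonal[of i j] off_diagonal[of j i] assms by (metis minus_minus neg_0_le_iff_le)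
  have zero: "a = 0 \<longleftrightarrow> b = 0"
    using off_diagonal_zero[of i j] off_diagonal_zero[of j i] assms(1,2) ab by linarith
  have num: "numeral k = enat m \<longleftrightarrow> m = numeral k" for k
    by (auto simp: numeral_eq_enat)
  have le: "a \<le> a * b" "b \<le> a * b" if "a * b > 0"
    using that ab zero_less_mult_iff[of a b] by (auto simp: mult_le_cancel_left1 mult_le_cancel_right1)
  have "(a * b = 0 \<and> m = 2) \<or> (a * b = 1 \<and> m = 3) \<or> (a * b = 2 \<and> m = 4) \<or> (a * b = 3 \<and> m = 6)"
    using assms(4) ab by (auto simp: coxeter_exponent_def Let_def num split: if_splits)
  then show thesis
  proof (elim disjE conjE)
    assume "a * b = 0" "m = 2"
    then show thesis using that(1) zero ab by auto
  next
    assume p: "a * b = 1" "m = 3"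
    then have "a \<in> {0..1}" "b \<in> {0..1}" using le ab by auto
    then have "a \<in> {0, 1}" "b \<in> {0, 1}" by auto
    then show thesis using that(2) p ab by auto
  next
    assume p: "a * b = 2" "m = 4"
    then have "a \<in> {0..2}" "b \<in> {0..2}" using le ab by auto
    then have "a \<in> {0, 1, 2}" "b \<in> {0, 1, 2}" by auto
    then show thesis using that(3,4) p ab by auto
  next
    assume p: "a * b = 3" "m = 6"
    then have "a \<in> {0..3}" "b \<in> {0..3}" using le ab by auto
    then have "a \<in> {0, 1, 2, 3}" "b \<in> {0, 1, 2, 3}" by auto
    then show thesis using that(5,6) p ab by auto
  qed
qed

lemma fire_braid:
  assumes "i \<in> I" "j \<in> I" "i \<noteq> j" "coxeter_exponent A i j = enat m"
  shows "foldr fire (concat (replicate m [i, j])) x = x"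
proof -
  have "foldr fire (concat (replicate m [i, j])) (shift i j x 0 0) = shift i j x 0 0"
    using finite_exponent_cases[OF assms]
    by cases (simp_all add: numeral_eq_Suc fire_shift assms(1,2) del: shift_0)
  then show ?thesis
    by simp
qed

lemma fire_cong:
  assumes "set xs \<subseteq> I" "set ys \<subseteq> I" "eval_word xs = eval_word ys"
  shows "foldr fire xs x = foldr fire ys x"
  by (rule word_invariant[where \<phi> = "\<lambda>xs. foldr fire xs x", OF assms])
    (simp_all add: fire_fire fire_braid)

text \<open>
  Here \<open>m\<^sub>i\<^sub>j = \<infinity>\<close>. Starting from value \<open>1\<close> at \<open>j\<close> and \<open>0\<close> at \<open>i\<close>, and firing \<open>j\<close> and \<open>i\<close> in turn,
  the node about to fire always has a positive value, so that the node that fired last keeps a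
  negative one and the starting position does not return.
\<close>

lemma fire_pair_no_fixed_power:
  assumes "i \<in> I" "j \<in> I" "i \<noteq> j" "A $$ (i, j) * A $$ (j, i) \<ge> 4" "k > 0"
  shows "foldr fire (concat (replicate k [i, j])) (\<lambda>l. of_bool (l = j)) i \<noteq> 0"
proof -
  define a b where "a = - A $$ (i, j)" and "b = - A $$ (j, i)"
  have ab: "a \<ge> 0" "b \<ge> 0" "a * b \<ge> 4"
    using off_diagonal[of i j] off_diagonal[of j i] assms by (auto simp: a_def b_def)
  have "b > 0"
    using ab by (cases "b = 0") auto
  let ?x = "\<lambda>k. foldr fire (concat (replicate k [i, j])) (\<lambda>l. of_bool (l = j))"
  \<comment> \<open>With \<open>y\<close> at \<open>j\<close> and \<open>- x\<close> at \<open>i\<close>, firing \<open>j\<close> and then \<open>i\<close> leads to the values \<open>a z - y\<close> and \<open>- z\<close>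
    for \<open>z = b y - x\<close>. The bound \<open>2 x \<le> b y\<close> propagates because \<open>a b \<ge> 4\<close>.\<close>
  have growth: "y > 0 \<and> 2 * x \<le> b * y \<Longrightarrow>
      b * y - x > 0 \<and> a * (b * y - x) - y > 0 \<and> 2 * (b * y - x) \<le> b * (a * (b * y - x) - y)"
    for x y :: int
  proof -
    assume *: "y > 0 \<and> 2 * x \<le> b * y"
    define z where "z = b * y - x"
    have "b * y > 0" using * \<open>b > 0\<close> by simp
    then have z: "2 * z \<ge> b * y" "z > 0" using * by (auto simp: z_def)
    have "4 * y \<le> (a * b) * y" using ab * by (intro mult_right_mono) auto
    also have "\<dots> \<le> a * (2 * z)" using mult_left_mono[OF z(1) ab(1)] by (simp add: mult.assoc)
    finally have az: "2 * y \<le> a * z" by simp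
    have "4 * z \<le> (a * b) * z" using ab z by (intro mult_right_mono) auto
    moreover have "b * (2 * y) \<le> b * (a * z)" using az ab by (intro mult_left_mono) auto
    ultimately have "2 * z \<le> b * (a * z - y)" by (simp add: algebra_simps)
    then show ?thesis using az z * unfolding z_def by auto
  qed
  have "?x k j > 0 \<and> 2 * - ?x k i \<le> b * ?x k j \<and> (k > 0 \<longrightarrow> ?x k i < 0)"
  proof (induction k)
    case 0
    then show ?case using assms \<open>b > 0\<close> by simp
  next
    case (Suc k)
    define x y where "x = - ?x k i" and "y = ?x k j"
    have "?x (Suc k) i = - (b * y - x)" "?x (Suc k) j = a * (b * y - x) - y"
      using assms by (auto simp: fire_def x_def y_def a_def b_def algebra_simps)
    then show ?case
      using growth[of y x] Suc by (simp add: x_def y_def)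
  qed
  then show ?thesis
    using assms(5) by auto
qed

lemma s_power_neq_one:
  assumes "i \<in> I" "j \<in> I" "i \<noteq> j" "0 < k" "enat k < coxeter_exponent A i j"
  shows "(s i \<cdot> s j) \<up> k \<noteq> \<e>"
proof
  assume "(s i \<cdot> s j) \<up> k = \<e>"
  then have "eval_word (concat (replicate k [i, j])) = eval_word []"
    using assms by (simp add: eval_word_alternating_pairs)
  then have fixed: "foldr fire (concat (replicate k [i, j])) x = x" for x
    using fire_cong[of "concat (replicate k [i, j])" "[]" x] assms set_alternating_pairs[of k i j]
    by auto
  show False
  proof (cases "coxeter_exponent A i j")
    case (enat m)
    let ?x = "\<lambda>l. of_bool (l = j) :: int"
    have k: "k < m"
      using assms enat by simp
    from finite_exponent_cases[OF assms(1-3) enat]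
    have "foldr fire (concat (replicate k [i, j])) (shift i j ?x 0 0) \<noteq> ?x"
    proof cases
      case 1
      with k assms(4) have "k = Suc 0" by auto
      then show ?thesis using 1 assms(1-3)
        by (simp add: fire_shift shift_neq del: shift_0)
    next
      case 2
      with k assms(4) have "k \<in> {Suc 0, Suc (Suc 0)}" by auto
      then show ?thesis using 2 assms(1-3)
        by (auto simp add: fire_shift shift_neq simp del: shift_0)
    next
      case 3
      with k assms(4) have "k \<in> {Suc 0, Suc (Suc 0), Suc (Suc (Suc 0))}" by auto
      then show ?thesis using 3 assms(1-3)
        by (auto simp add: fire_shift shift_neq simp del: shift_0)
    next
      case 4
      with k assms(4) have "k \<in> {Suc 0, Suc (Suc 0), Suc (Suc (Suc 0))}" by auto
      then show ?thesis using 4 assms(1-3)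
        by (auto simp add: fire_shift shift_neq simp del: shift_0)
    next
      case 5
      with k assms(4) have "k \<in> {Suc 0, Suc (Suc 0), Suc (Suc (Suc 0)), Suc (Suc (Suc (Suc 0))),
        Suc (Suc (Suc (Suc (Suc 0))))}" by auto
      then show ?thesis using 5 assms(1-3)
        by (auto simp add: fire_shift shift_neq simp del: shift_0)
    next
      case 6
      with k assms(4) have "k \<in> {Suc 0, Suc (Suc 0), Suc (Suc (Suc 0)), Suc (Suc (Suc (Suc 0))),
        Suc (Suc (Suc (Suc (Suc 0))))}" by auto
      then show ?thesis using 6 assms(1-3)
        by (auto simp add: fire_shift shift_neq simp del: shift_0)
    qed
    then show False
      using fixed by simp
  next
    case infinity
    then have "A $$ (i, j) * A $$ (j, i) \<notin> {0, 1, 2, 3}"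
      by (auto simp: coxeter_exponent_def Let_def split: if_splits)
    moreover have "A $$ (i, j) * A $$ (j, i) \<ge> 0"
      using off_diagonal assms by (simp add: mult_nonpos_nonpos)
    moreover have "p \<ge> 4" if "p \<notin> {0, 1, 2, 3}" "p \<ge> 0" for p :: int
      using that by auto
    ultimately have "A $$ (i, j) * A $$ (j, i) \<ge> 4"
      by blast
    from fire_pair_no_fixed_power[OF assms(1-3) this assms(4)] show False
      using assms by (simp add: fixed)
  qed
qed

section \<open>Alternating words and triangles in the Weyl group\<close>

lemma reduced_alt:
  assumes "i \<in> I" "j \<in> I" "i \<noteq> j" "enat k \<le> coxeter_exponent A i j"
  shows "reduced (alt i j k)"
proof (rule reduced_if_distinct_refls)
  have "(s i \<cdot> s j) \<up> p \<cdot> s i \<noteq> (s i \<cdot> s j) \<up> q \<cdot> s i" if "p < q" "q < k" for p q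
  proof
    assume "(s i \<cdot> s j) \<up> p \<cdot> s i = (s i \<cdot> s j) \<up> q \<cdot> s i"
    then have "(s i \<cdot> s j) \<up> p = (s i \<cdot> s j) \<up> q"
      using assms by (simp add: right_cancel)
    also have "\<dots> = (s i \<cdot> s j) \<up> p \<cdot> (s i \<cdot> s j) \<up> (q - p)"
      using assms that nat_pow_mult[of "s i \<cdot> s j" p "q - p"] by simp
    finally have "(s i \<cdot> s j) \<up> (q - p) = \<e>"
      using assms by (metis l_cancel_one' m_closed nat_pow_closed s_closed)
    moreover have "enat (q - p) < coxeter_exponent A i j"
      using that by (intro less_le_trans[OF _ assms(4)]) auto
    ultimately show False
      using s_power_neq_one[of i j "q - p"] assms that by auto
  qed
  then have "inj_on (\<lambda>p. (s i \<cdot> s j) \<up> p \<cdot> s i) {0..<k}"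
    by (intro linorder_inj_onI') auto
  then show "distinct (refls (alt i j k))"
    using assms by (simp add: refls_alt distinct_map)
qed (use assms set_alt_I in auto)

text \<open>
  Fire the three nodes cyclically, starting from value \<open>1\<close> everywhere. If \<open>i\<close> is about to fire, \<open>j\<close>
  is next and \<open>l\<close> fired last, the inequalities \<open>x i > 0\<close>, \<open>x j > 0\<close> and \<open>x i + x l > 0\<close> persist,
  and the value about to fire grows at each step because \<open>j\<close> receives at least \<open>x i\<close>.
\<close>

lemma fire_triangle_unbounded:
  assumes "{a, b, c} \<subseteq> I" "a \<noteq> b" "b \<noteq> c" "a \<noteq> c"
    and neg: "\<And>i j. i \<in> {a, b, c} \<Longrightarrow> j \<in> {a, b, c} \<Longrightarrow> i \<noteq> j \<Longrightarrow> A $$ (i, j) < 0"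
  shows "\<exists>xs i. set xs \<subseteq> {a, b, c} \<and> i \<in> {a, b, c} \<and> foldr fire xs (\<lambda>_. 1) i > int k"
proof -
  have "\<exists>xs i j l. set xs \<subseteq> {a, b, c} \<and> {i, j, l} = {a, b, c} \<and>
    (let x = foldr fire xs (\<lambda>_. 1) in x i > int k \<and> x j > 0 \<and> x i + x l > 0)"
  proof (induction k)
    case 0
    show ?case
      by (rule exI[of _ "[]"], rule exI[of _ a], rule exI[of _ b], rule exI[of _ c]) simp
  next
    case (Suc k)
    then obtain xs i j l where *: "set xs \<subseteq> {a, b, c}" "{i, j, l} = {a, b, c}"
      and **: "foldr fire xs (\<lambda>_. 1) i > int k" "foldr fire xs (\<lambda>_. 1) j > 0"
        "foldr fire xs (\<lambda>_. 1) i + foldr fire xs (\<lambda>_. 1) l > 0"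
      unfolding Let_def by blast
    define x where "x = foldr fire xs (\<lambda>_. 1)"
    have "card {i, j, l} = 3"
      using * assms(2-4) by simp
    then have d: "i \<noteq> j" "i \<noteq> l" "j \<noteq> l"
      by (auto simp: card_insert_if split: if_splits)
    have "i \<in> {a, b, c}" "j \<in> {a, b, c}" "l \<in> {a, b, c}"
      using *(2) by blast+
    then have A: "- A $$ (i, j) \<ge> 1" "- A $$ (i, l) \<ge> 1" and i: "i \<in> I"
      using neg[of i j] neg[of i l] d assms(1) by auto
    have "x i > 0"
      using ** by (simp add: x_def)
    then have "1 * x i \<le> - A $$ (i, j) * x i" "1 * x i \<le> - A $$ (i, l) * x i"
      using A by (intro mult_right_mono; simp)+
    then have "fire i x j > int (Suc k) \<and> fire i x l > 0 \<and> fire i x j + fire i x i > 0"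
      using ** i by (auto simp: fire_def x_def)
    moreover have "foldr fire (i # xs) (\<lambda>_. 1) = fire i x" "set (i # xs) \<subseteq> {a, b, c}"
      "{j, l, i} = {a, b, c}"
      using * by (auto simp: x_def)
    ultimately show ?case
      unfolding Let_def by metis
  qed
  then show ?thesis
    unfolding Let_def by blast
qed

text \<open>
  Otherwise all elements of the subgroup generated by the triangle have words of at most \<open>len w\<close>
  letters. There are only finitely many of these, whereas the values in the numbers game played on
  the triangle are unbounded.
\<close>

lemma no_triangle_of_descents:
  assumes "w \<in> W" "{a, b, c} \<subseteq> descents w" "a \<noteq> b" "b \<noteq> c" "a \<noteq> c"
    and neg: "\<And>i j. i \<in> {a, b, c} \<Longrightarrow> j \<in> {a, b, c} \<Longrightarrow> i \<noteq> j \<Longrightarrow> A $$ (i, j) < 0"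
  shows False
proof -
  let ?J = "{a, b, c}"
  have J: "?J \<subseteq> I"
    using assms(2) by (auto simp: descents_def)
  let ?value = "\<lambda>(ys, i). foldr fire ys (\<lambda>_. 1) i"
  let ?V = "?value ` ({ys. set ys \<subseteq> ?J \<and> length ys \<le> len w} \<times> ?J)"
  have "finite ?V"
    by (intro finite_imageI finite_cartesian_product finite_lists_length_le) auto
  define m where "m = Max ?V"
  have m: "v \<le> m" if "v \<in> ?V" for v
    unfolding m_def by (rule Max_ge[OF \<open>finite ?V\<close> that])
  obtain xs i where xs: "set xs \<subseteq> ?J" "i \<in> ?J" "foldr fire xs (\<lambda>_. 1) i > int (nat m)"
    using fire_triangle_unbounded[OF J assms(3-5) neg] by blast
  obtain ys where ys: "reduced ys" "set ys \<subseteq> set xs" "eval_word ys = eval_word xs"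
    using reduced_subword_exists[of xs] xs J by blast
  have "starts_with ys w"
    using starts_with_reduced[OF assms(1,2) ys(1)] ys xs by auto
  then have "?value (ys, i) \<in> ?V"
    using xs ys by (intro imageI) (auto simp: starts_with_def)
  then have "foldr fire ys (\<lambda>_. 1) i \<le> m"
    using m[of "foldr fire ys (\<lambda>_. 1) i"] by simp
  moreover have "foldr fire ys (\<lambda>_. 1) = foldr fire xs (\<lambda>_. 1)"
    using ys xs J by (intro fire_cong) (auto simp: reduced_def)
  ultimately show False
    using xs(3) by (simp split: if_splits)
qed

end

section \<open>Length generating functions\<close>

definition geometric_fps :: "nat \<Rightarrow> int fps" where
  "geometric_fps m = (\<Sum>k<m. fps_X ^ k)"

text \<open>
  The series \<open>t / (1 + t)\<close>; the last argument of \<open>fps_right_inverse\<close> is the inverse of the constant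
  coefficient.
\<close>

definition vertex_weight :: "int fps" where
  "vertex_weight = fps_X * fps_right_inverse (1 + fps_X) 1"

text \<open>
  The series \<open>t\<^sup>m / ((1 + t) (1 + t + \<dots> + t\<^sup>m\<^sup>-\<^sup>1))\<close>: its denominator is the Poincare series of the
  dihedral group of order \<open>2 m\<close>, and \<open>m\<close> is the length of its longest element.
\<close>

definition edge_weight :: "enat \<Rightarrow> int fps" where
  "edge_weight e = (case e of
      enat m \<Rightarrow> fps_X ^ m * fps_right_inverse ((1 + fps_X) * geometric_fps m) 1
    | \<infinity> \<Rightarrow> 0)"

lemma geometric_fps_Suc: "geometric_fps (Suc m) = 1 + fps_X * geometric_fps m"
  by (simp add: geometric_fps_def sum.lessThan_Suc_shift sum_distrib_left del: sum.lessThan_Suc)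

lemma vertex_weight_eq:
  assumes "(1 + fps_X) * d = fps_X * (P :: int fps)"
  shows "d = vertex_weight * P"
proof -
  let ?r = "fps_right_inverse (1 + fps_X :: int fps) 1"
  have u: "(1 + fps_X) * ?r = 1"
    by (rule fps_right_inverse) simp
  have "d = ((1 + fps_X) * ?r) * d"
    by (simp only: u mult_1_left)
  also have "\<dots> = ?r * ((1 + fps_X) * d)"
    by (simp only: mult_ac)
  also have "\<dots> = ?r * (fps_X * P)"
    by (simp only: assms)
  also have "\<dots> = vertex_weight * P"
    by (simp only: vertex_weight_def mult_ac)
  finally show ?thesis .
qed

lemma edge_weight_eq:
  assumes "(1 + fps_X) * geometric_fps m * b = fps_X ^ m * P" "m > 0"
  shows "b = edge_weight (enat m) * P"
proof -
  let ?u = "(1 + fps_X) * geometric_fps m"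
  let ?r = "fps_right_inverse ?u 1"
  have "fps_nth (geometric_fps m) 0 = 1"
    using assms(2) by (cases m) (auto simp: geometric_fps_Suc)
  then have u: "?u * ?r = 1"
    by (intro fps_right_inverse) simp
  have "b = (?u * ?r) * b"
    by (simp only: u mult_1_left)
  also have "\<dots> = ?r * (?u * b)"
    by (simp only: mult_ac)
  also have "\<dots> = ?r * (fps_X ^ m * P)"
    by (simp only: assms)
  also have "\<dots> = edge_weight (enat m) * P"
    by (simp only: edge_weight_def enat.case mult_ac)
  finally show ?thesis .
qed

context weyl
begin

definition length_gf :: "nat gword set set \<Rightarrow> int fps" where
  "length_gf X = Abs_fps (\<lambda>k. int (card {w \<in> X. len w = k}))"

lemma length_gf_W: "length_gf W = poincare_series A"
  by (simp add: length_gf_def poincare_series_def)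

lemma length_gf_empty [simp]: "length_gf {} = 0"
  by (rule fps_ext) (simp add: length_gf_def)

lemma finite_level: "X \<subseteq> W \<Longrightarrow> finite {w \<in> X. len w = k}"
  by (rule finite_subset[OF _ finite_weyl_length_eq[of A k]]) auto

lemma length_gf_Diff:
  assumes "X \<subseteq> W" "Y \<subseteq> X"
  shows "length_gf (X - Y) = length_gf X - length_gf Y"
proof (rule fps_ext)
  fix k
  have "{w \<in> X - Y. len w = k} = {w \<in> X. len w = k} - {w \<in> Y. len w = k}"
    by auto
  moreover have "card \<dots> = card {w \<in> X. len w = k} - card {w \<in> Y. len w = k}"
    using assms by (intro card_Diff_subset finite_level) auto
  moreover have "card {w \<in> Y. len w = k} \<le> card {w \<in> X. len w = k}"
    using assms by (intro card_mono finite_level) auto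
  ultimately show "fps_nth (length_gf (X - Y)) k = fps_nth (length_gf X - length_gf Y) k"
    by (simp add: length_gf_def)
qed

lemma length_gf_s_mult:
  assumes "i \<in> I" "X \<subseteq> W" "\<And>w. w \<in> X \<Longrightarrow> i \<notin> descents w"
  shows "length_gf ((\<lambda>w. s i \<cdot> w) ` X) = fps_X * length_gf X"
proof (rule fps_ext)
  fix k
  have len: "len (s i \<cdot> w) = Suc (len w)" if "w \<in> X" for w
    using assms that len_s_mult_if_not_descent by auto
  have inj: "inj_on (\<lambda>w. s i \<cdot> w) X"
    by (rule inj_on_inverseI[where g = "\<lambda>w. s i \<cdot> w"]) (use assms in auto)
  have "card {w \<in> (\<lambda>w. s i \<cdot> w) ` X. len w = k} = (if k = 0 then 0 else card {w \<in> X. len w = k - 1})"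
  proof (cases k)
    case 0
    then have none: "{w \<in> (\<lambda>w. s i \<cdot> w) ` X. len w = k} = {}"
      using len by auto
    show ?thesis unfolding none using 0 by simp
  next
    case (Suc l)
    then have "{w \<in> (\<lambda>w. s i \<cdot> w) ` X. len w = k} = (\<lambda>w. s i \<cdot> w) ` {w \<in> X. len w = l}"
      using len by auto
    then show ?thesis
      using Suc card_image[OF inj_on_subset[OF inj, of "{w \<in> X. len w = l}"]] by auto
  qed
  then show "fps_nth (length_gf ((\<lambda>w. s i \<cdot> w) ` X)) k = fps_nth (fps_X * length_gf X) k"
    by (simp add: length_gf_def fps_X_mult_nth)
qed

text \<open>
  Multiplication by \<open>s\<^sub>i\<close> maps the elements without descent \<open>i\<close> bijectively to those with it, and
  raises the length by one. So the series \<open>d\<close> of the latter satisfies \<open>d = t (P - d)\<close>.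
\<close>

lemma vertex_gf:
  assumes "i \<in> I"
  shows "length_gf {w \<in> W. i \<in> descents w} = vertex_weight * poincare_series A"
proof -
  let ?D = "{w \<in> W. i \<in> descents w}"
  have "w \<in> (\<lambda>w. s i \<cdot> w) ` (W - ?D)" if "w \<in> ?D" for w
    using that assms s_mult_descents_iff[of i w] by (intro image_eqI[of _ _ "s i \<cdot> w"]) auto
  then have "?D = (\<lambda>w. s i \<cdot> w) ` (W - ?D)"
    using assms s_mult_descents_iff[of i] by auto
  then have "length_gf ?D = length_gf ((\<lambda>w. s i \<cdot> w) ` (W - ?D))"
    by simp
  also have "\<dots> = fps_X * length_gf (W - ?D)"
    using assms by (intro length_gf_s_mult) auto
  also have "length_gf (W - ?D) = poincare_series A - length_gf ?D"
    by (simp add: length_gf_Diff length_gf_W)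
  finally show ?thesis
    by (intro vertex_weight_eq) (simp add: algebra_simps)
qed

lemma descents_subset: "descents w \<subseteq> I"
  by (auto simp: descents_def)

lemma descents_empty_iff:
  assumes "w \<in> W"
  shows "descents w = {} \<longleftrightarrow> w = \<e>"
proof
  assume "w = \<e>"
  then show "descents w = {}"
    by (simp add: descents_def)
next
  assume empty: "descents w = {}"
  obtain xs where xs: "reduced xs" "eval_word xs = w"
    using reduced_word_exists[OF assms] .
  show "w = \<e>"
  proof (cases xs)
    case (Cons i ys)
    then have "reduced ys" "i \<in> I"
      using xs reduced_ConsD by (auto simp: reduced_def)
    then have "i \<in> descents w"
      using xs Cons by (auto simp: descents_def reduced_def)
    then show ?thesis
      using empty by simp
  qed (use xs in simp)
qed

end

context weyl_of_cartan
begin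

lemma coxeter_exponent_commute: "coxeter_exponent A i j = coxeter_exponent A j i"
  by (simp add: coxeter_exponent_def mult.commute)

text \<open>
  Removing the first letter \<open>i\<close> leaves the elements that begin with the shorter word and do not have
  the descent \<open>i\<close>. Among the elements that begin with \<open>alt j i k\<close>, which all have the descent \<open>j\<close>
  because \<open>k > 0\<close>, the excluded ones are those with both descents; conversely every element with
  both descents begins with \<open>alt j i k\<close>, as this word is reduced.
\<close>

lemma edge_gf_recursion:
  assumes "i \<in> I" "j \<in> I" "i \<noteq> j" "k > 0" "enat k \<le> coxeter_exponent A i j"
  shows "length_gf {w \<in> W. starts_with (alt i j (Suc k)) w} =
    fps_X * (length_gf {w \<in> W. starts_with (alt j i k) w} - length_gf {w \<in> W. {i, j} \<subseteq> descents w})"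
proof -
  let ?S = "{w \<in> W. starts_with (alt j i k) w}" and ?B = "{w \<in> W. {i, j} \<subseteq> descents w}"
  have red: "reduced (alt j i k)"
    using reduced_alt[of j i k] assms coxeter_exponent_commute[of i j] by simp
  have j: "j \<in> descents w" if "w \<in> ?S" for w
  proof -
    obtain l where "k = Suc l"
      using assms(4) by (cases k) auto
    then show ?thesis
      using that assms starts_with_Cons_iff[of j "alt i j l" w] by (simp add: set_alt_I)
  qed
  have B: "?B \<subseteq> ?S"
    using starts_with_reduced[OF _ _ red, of _ "{i, j}"] set_alt_subset[of j i k] by auto
  have B_iff: "w \<in> ?S - ?B \<longleftrightarrow> w \<in> ?S \<and> i \<notin> descents w" for w
    using j by auto
  have step: "starts_with (alt i j (Suc k)) w \<longleftrightarrow> i \<in> descents w \<and> starts_with (alt j i k) (s i \<cdot> w)"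
    if "w \<in> W" for w
    using starts_with_Cons_iff[of i "alt j i k" w] that assms by (simp add: set_alt_I)
  have "{w \<in> W. starts_with (alt i j (Suc k)) w} = (\<lambda>w. s i \<cdot> w) ` (?S - ?B)"
  proof (intro equalityI subsetI)
    fix w assume w: "w \<in> {w \<in> W. starts_with (alt i j (Suc k)) w}"
    then have "s i \<cdot> w \<in> ?S - ?B"
      unfolding B_iff using step assms s_mult_descents_iff[of i w] by auto
    then show "w \<in> (\<lambda>w. s i \<cdot> w) ` (?S - ?B)"
      using w assms by (intro image_eqI[of _ _ "s i \<cdot> w"]) auto
  next
    fix w assume "w \<in> (\<lambda>w. s i \<cdot> w) ` (?S - ?B)"
    then obtain v where v: "w = s i \<cdot> v" "v \<in> ?S" "i \<notin> descents v"
      using B_iff by blast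
    then show "w \<in> {w \<in> W. starts_with (alt i j (Suc k)) w}"
      using step[of w] assms s_mult_descents_iff[of i v] by auto
  qed
  then have "length_gf {w \<in> W. starts_with (alt i j (Suc k)) w} =
      length_gf ((\<lambda>w. s i \<cdot> w) ` (?S - ?B))"
    by (rule arg_cong)
  also have "\<dots> = fps_X * length_gf (?S - ?B)"
    using assms(1) B_iff by (intro length_gf_s_mult) blast+
  also have "length_gf (?S - ?B) = length_gf ?S - length_gf ?B"
    using B by (intro length_gf_Diff) blast+
  finally show ?thesis .
qed

lemma edge_gf_sum:
  assumes "i \<in> I" "j \<in> I" "i \<noteq> j" "enat (Suc k) \<le> coxeter_exponent A i j"
  shows "length_gf {w \<in> W. starts_with (alt i j (Suc k)) w} +
      fps_X * geometric_fps k * length_gf {w \<in> W. {i, j} \<subseteq> descents w} =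
    fps_X ^ k * (vertex_weight * poincare_series A)"
  using assms
proof (induction k arbitrary: i j)
  case 0
  then have "{w \<in> W. starts_with (alt i j (Suc 0)) w} = {w \<in> W. i \<in> descents w}"
    using starts_with_Cons_iff[of i "[]"] by auto
  then show ?case
    using vertex_gf[of i] 0 by (simp add: geometric_fps_def)
next
  case (Suc k)
  let ?b = "length_gf {w \<in> W. {i, j} \<subseteq> descents w}"
  have le: "enat (Suc k) \<le> coxeter_exponent A i j"
    using Suc.prems(4) by (rule order_trans[rotated]) simp
  have IH: "length_gf {w \<in> W. starts_with (alt j i (Suc k)) w} + fps_X * geometric_fps k * ?b =
      fps_X ^ k * (vertex_weight * poincare_series A)"
    using Suc.IH[of j i] Suc.prems le coxeter_exponent_commute[of i j] by (simp add: insert_commute)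
  have rec: "length_gf {w \<in> W. starts_with (alt i j (Suc (Suc k))) w} =
      fps_X * (length_gf {w \<in> W. starts_with (alt j i (Suc k)) w} - ?b)"
    using edge_gf_recursion[of i j "Suc k"] Suc.prems le by blast
  have "fps_X * (length_gf {w \<in> W. starts_with (alt j i (Suc k)) w} - ?b) +
      fps_X * geometric_fps (Suc k) * ?b =
    fps_X * (length_gf {w \<in> W. starts_with (alt j i (Suc k)) w} + fps_X * geometric_fps k * ?b)"
    by (simp add: geometric_fps_Suc algebra_simps)
  also have "\<dots> = fps_X * (fps_X ^ k * (vertex_weight * poincare_series A))"
    by (simp only: IH)
  finally show ?case
    by (simp only: rec power_Suc mult.assoc)
qed

text \<open>
  For finite \<open>m\<close>, the two alternating words of \<open>m\<close> letters represent the same element, so that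
  beginning with either of them is the same as having both descents, and the recursion closes up.
  For \<open>m = \<infinity>\<close>, an element with both descents would begin with arbitrarily long words.
\<close>

lemma edge_gf:
  assumes "i \<in> I" "j \<in> I" "i \<noteq> j"
  shows "length_gf {w \<in> W. {i, j} \<subseteq> descents w} =
    edge_weight (coxeter_exponent A i j) * poincare_series A"
proof (cases "coxeter_exponent A i j")
  case (enat m)
  let ?b = "length_gf {w \<in> W. {i, j} \<subseteq> descents w}"
  have "m > 0"
    by (rule finite_exponent_cases[OF assms enat]) auto
  then obtain k where k: "m = Suc k"
    by (cases m) auto
  have red: "reduced (alt i j m)"
    using reduced_alt assms enat by simp
  have swap: "starts_with (alt i j m) w \<longleftrightarrow> starts_with (alt j i m) w" for w
    using eval_alt_swap_exponent[OF assms enat] by (simp add: starts_with_def)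
  have "starts_with (alt i j m) w \<longleftrightarrow> {i, j} \<subseteq> descents w" if w: "w \<in> W" for w
  proof
    assume "starts_with (alt i j m) w"
    then have "starts_with (i # alt j i k) w" "starts_with (j # alt i j k) w"
      using swap[of w] by (simp_all add: k)
    then show "{i, j} \<subseteq> descents w"
      using w assms by (simp add: starts_with_Cons_iff set_alt_I)
  next
    assume "{i, j} \<subseteq> descents w"
    then show "starts_with (alt i j m) w"
      using starts_with_reduced[OF w _ red] set_alt_subset[of i j m] by blast
  qed
  then have "{w \<in> W. starts_with (alt i j m) w} = {w \<in> W. {i, j} \<subseteq> descents w}"
    by blast
  then have "?b + fps_X * geometric_fps k * ?b = fps_X ^ k * (vertex_weight * poincare_series A)"
    using edge_gf_sum[of i j k] assms enat k by simp
  then have "geometric_fps m * ?b = fps_X ^ k * (vertex_weight * poincare_series A)"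
    by (simp add: k geometric_fps_Suc algebra_simps)
  moreover have "(1 + fps_X) * vertex_weight = fps_X"
    using fps_right_inverse[of "1 + fps_X :: int fps" 1] by (simp add: vertex_weight_def mult.left_commute)
  ultimately have "(1 + fps_X) * geometric_fps m * ?b = fps_X ^ m * poincare_series A"
    by (simp add: k mult_ac)
  then show ?thesis
    using edge_weight_eq[OF _ \<open>m > 0\<close>] enat by simp
next
  case infinity
  have False if "w \<in> W" "{i, j} \<subseteq> descents w" for w
  proof -
    have "starts_with (alt i j (Suc (len w))) w"
      using reduced_alt[OF assms, of "Suc (len w)"] infinity set_alt_subset[of i j "Suc (len w)"]
      by (intro starts_with_reduced[OF that]) auto
    then show False
      by (auto simp: starts_with_def)
  qed
  then have empty: "{w \<in> W. {i, j} \<subseteq> descents w} = {}"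
    by blast
  show ?thesis
    unfolding empty using infinity by (simp add: edge_weight_def)
qed

end

section \<open>The Poincare series of large type\<close>

definition below_diagonal :: "nat \<Rightarrow> (nat \<times> nat) set" where
  "below_diagonal n = {(i, j). j < i \<and> i < n}"

lemma finite_below_diagonal [simp]: "finite (below_diagonal n)"
  by (rule finite_subset[of _ "{..<n} \<times> {..<n}"]) (auto simp: below_diagonal_def)

text \<open>
  The higher terms of the alternating sum over the subsets of \<open>D\<close> vanish if \<open>D\<close> has at most two
  elements.
\<close>

lemma inclusion_exclusion_small:
  assumes "D \<subseteq> {..<n}" "card D \<le> 2"
  shows "(of_bool (D = {}) :: int) =
    1 - (\<Sum>i<n. of_bool (i \<in> D)) + (\<Sum>(i, j)\<in>below_diagonal n. of_bool ({i, j} \<subseteq> D))"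
proof -
  have fin: "finite D"
    using assms(1) finite_subset by blast
  have "(\<Sum>i<n. of_bool (i \<in> D)) = int (card D)"
    using assms(1) by (simp add: Int_absorb1 flip: of_nat_sum)
  moreover have "(\<Sum>(i, j)\<in>below_diagonal n. of_bool ({i, j} \<subseteq> D)) = int (card {(i, j) \<in> below_diagonal n. {i, j} \<subseteq> D})"
    by (simp add: case_prod_unfold Int_def flip: of_nat_sum)
  moreover have "int (card {(i, j) \<in> below_diagonal n. {i, j} \<subseteq> D}) = of_bool (D = {}) - 1 + int (card D)"
  proof -
    consider "card D = 0" | "card D = 1" | "card D = 2"
      using assms(2) by linarith
    then show ?thesis
    proof cases
      case 1
      then show ?thesis using fin by (simp add: case_prod_unfold)
    next
      case 2
      then obtain a where a: "D = {a}" by (auto simp: card_1_singleton_iff)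
      then have none: "{(i, j) \<in> below_diagonal n. {i, j} \<subseteq> D} = {}" by (auto simp: below_diagonal_def)
      show ?thesis unfolding none by (simp add: a)
    next
      case 3
      then obtain a b where ab: "D = {a, b}" "a < b"
        by (metis card_2_iff insert_commute linorder_neqE_nat)
      then have one: "{(i, j) \<in> below_diagonal n. {i, j} \<subseteq> D} = {(b, a)}"
        using assms(1) by (auto simp: below_diagonal_def)
      show ?thesis unfolding one using ab by simp
    qed
  qed
  ultimately show ?thesis by simp
qed

text \<open>
  Coxeter groups in which no two distinct generators commute are said to be of large type.
\<close>

locale large_type_weyl = weyl_of_cartan +
  assumes off_diagonal_neg: "\<And>i j. i < n \<Longrightarrow> j < n \<Longrightarrow> i \<noteq> j \<Longrightarrow> A $$ (i, j) < 0"
begin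

lemma card_descents_le_2:
  assumes "w \<in> W"
  shows "card (descents w) \<le> 2"
proof (rule ccontr)
  assume "\<not> card (descents w) \<le> 2"
  then have "3 \<le> card (descents w)" by simp
  then obtain T where T: "T \<subseteq> descents w" "card T = 3"
    by (meson obtain_subset_with_card_n)
  then obtain a b c where abc: "T = {a, b, c}" "a \<noteq> b" "b \<noteq> c" "a \<noteq> c"
    by (auto simp: card_3_iff)
  then have "{a, b, c} \<subseteq> I"
    using T descents_subset[of w] by auto
  then show False
    using no_triangle_of_descents[OF assms, of a b c] T abc off_diagonal_neg by (auto simp: I_eq)
qed

theorem poincare_series_formula:
  "poincare_series A *
    (1 - of_nat n * vertex_weight + (\<Sum>(i, j)\<in>below_diagonal n. edge_weight (coxeter_exponent A i j))) = 1"
proof -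
  let ?D = "\<lambda>i. {w \<in> W. i \<in> descents w}" and ?B = "\<lambda>i j. {w \<in> W. {i, j} \<subseteq> descents w}"
  \<comment> \<open>Coefficientwise, this is inclusion-exclusion over the descents of each single element.\<close>
  have "length_gf W - (\<Sum>i<n. length_gf (?D i)) + (\<Sum>(i, j)\<in>below_diagonal n. length_gf (?B i j)) = 1"
  proof (rule fps_ext)
    fix k
    define L where "L = {w \<in> W. len w = k}"
    have fin: "finite L"
      unfolding L_def by (rule finite_weyl_length_eq)
    have coeff: "fps_nth (length_gf {w \<in> W. P w}) k = (\<Sum>w\<in>L. of_bool (P w))" for P
    proof -
      have "{w \<in> {w \<in> W. P w}. len w = k} = L \<inter> {w. P w}"
        by (auto simp: L_def)
      then show ?thesis
        using fin by (simp add: length_gf_def flip: of_nat_sum)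
    qed
    have "fps_nth (length_gf W - (\<Sum>i<n. length_gf (?D i)) + (\<Sum>(i, j)\<in>below_diagonal n. length_gf (?B i j))) k =
      fps_nth (length_gf {w \<in> W. True}) k - (\<Sum>i<n. fps_nth (length_gf (?D i)) k) +
        (\<Sum>(i, j)\<in>below_diagonal n. fps_nth (length_gf (?B i j)) k)"
      by (simp add: fps_sum_nth case_prod_unfold)
    also have "\<dots> = (\<Sum>w\<in>L. 1) - (\<Sum>i<n. \<Sum>w\<in>L. of_bool (i \<in> descents w)) +
        (\<Sum>p\<in>below_diagonal n. \<Sum>w\<in>L. of_bool ({fst p, snd p} \<subseteq> descents w))"
      unfolding coeff case_prod_unfold by simp
    also have "\<dots> = (\<Sum>w\<in>L. 1 - (\<Sum>i<n. of_bool (i \<in> descents w)) +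
        (\<Sum>(i, j)\<in>below_diagonal n. of_bool ({i, j} \<subseteq> descents w)))"
      unfolding sum.distrib sum_subtractf case_prod_unfold
      by (simp only: sum.swap[of _ L])
    also have "\<dots> = (\<Sum>w\<in>L. of_bool (w = \<e>))"
    proof (rule sum.cong[OF HOL.refl])
      fix w assume "w \<in> L"
      then have w: "w \<in> W"
        by (simp add: L_def)
      show "1 - (\<Sum>i<n. of_bool (i \<in> descents w)) + (\<Sum>(i, j)\<in>below_diagonal n. of_bool ({i, j} \<subseteq> descents w)) =
          (of_bool (w = \<e>) :: int)"
        using inclusion_exclusion_small[OF _ card_descents_le_2[OF w]] descents_subset[of w]
          descents_empty_iff[OF w] by (simp add: I_eq)
    qed
    also have "\<dots> = int (card (L \<inter> {\<e>}))"
      using fin by (simp flip: of_nat_sum)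
    also have "\<dots> = fps_nth 1 k"
      by (auto simp: L_def)
    finally show "fps_nth (length_gf W - (\<Sum>i<n. length_gf (?D i)) +
      (\<Sum>(i, j)\<in>below_diagonal n. length_gf (?B i j))) k = fps_nth 1 k" .
  qed
  moreover have "(\<Sum>i<n. length_gf (?D i)) = of_nat n * vertex_weight * poincare_series A"
    by (simp add: vertex_gf I_eq mult.assoc)
  moreover have "(\<Sum>(i, j)\<in>below_diagonal n. length_gf (?B i j)) =
      (\<Sum>(i, j)\<in>below_diagonal n. edge_weight (coxeter_exponent A i j)) * poincare_series A"
    unfolding sum_distrib_right by (rule sum.cong) (auto simp: below_diagonal_def edge_gf I_eq simp del: insert_subset)
  ultimately show ?thesis
    by (simp add: length_gf_W algebra_simps)
qed

end

lemma large_type_weylI: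
  assumes "A \<in> carrier_mat n n" "\<And>r. r < n \<Longrightarrow> A $$ (r, r) = 2"
    and lower: "\<And>r c. r < n \<Longrightarrow> c < r \<Longrightarrow> A $$ (r, c) \<in> {-1, -2, -3, -4}"
    and upper: "\<And>r c. c < n \<Longrightarrow> r < c \<Longrightarrow> A $$ (r, c) = -1"
  shows "large_type_weyl A n"
proof -
  have neg: "A $$ (r, c) < 0" if "r < n" "c < n" "r \<noteq> c" for r c
    using that lower[of r c] upper[of c r] by (cases "c < r") auto
  then have "A $$ (r, c) \<le> 0 \<and> A $$ (r, c) \<noteq> 0" if "r < n" "c < n" "r \<noteq> c" for r c
    using that by force
  then have "cartan_matrix n A"
    using assms(1,2) unfolding cartan_matrix_def by (metis zero_neq_numeral)
  then show ?thesis
    using neg by unfold_locales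
qed

theorem theorem2:
  fixes A :: "int mat" and n i j i' j' :: nat
  assumes "cartan_matrix n A"
    and "\<And>r c. r < n \<Longrightarrow> c < r \<Longrightarrow> A $$ (r, c) \<in> {-1, -2, -3, -4}"
    and "\<And>r c. c < n \<Longrightarrow> r < c \<Longrightarrow> A $$ (r, c) = -1"
    and "j < i" "i < n" and "j' < i'" "i' < n"
  shows "poincare_series (swap_entries A (i, j) (i', j')) = poincare_series A"
proof -
  define A' where "A' = swap_entries A (i, j) (i', j')"
  define \<tau> where "\<tau> r = (if r = (i, j) then (i', j') else if r = (i', j') then (i, j) else r)" for r
  have carrier: "A \<in> carrier_mat n n"
    using assms(1) by (simp add: cartan_matrix_def)
  have entry: "A' $$ r = A $$ \<tau> r" if "fst r < n" "snd r < n" for r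
    using that carrier by (cases r) (auto simp: A'_def swap_entries_def \<tau>_def)
  have \<tau>_below_diagonal: "\<tau> r \<in> below_diagonal n" if "r \<in> below_diagonal n" for r
    using that assms(4-7) by (auto simp: \<tau>_def below_diagonal_def)
  have lower: "A' $$ (r, c) \<in> {-1, -2, -3, -4}" if "r < n" "c < r" for r c
  proof -
    have pair: "\<tau> (r, c) \<in> below_diagonal n"
      using that by (intro \<tau>_below_diagonal) (simp add: below_diagonal_def)
    obtain x y where xy: "\<tau> (r, c) = (x, y)"
      by (cases "\<tau> (r, c)")
    then show ?thesis
      using entry[of "(r, c)"] that pair assms(2)[of x y] by (simp add: below_diagonal_def)
  qed
  have upper: "A' $$ (r, c) = -1" if "c < n" "r < c" for r c
    using entry[of "(r, c)"] that assms(3-7) by (auto simp: \<tau>_def)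
  have diag: "A' $$ (r, r) = 2" if "r < n" for r
    using entry[of "(r, r)"] that assms(1,4-7) by (auto simp: \<tau>_def cartan_matrix_def)
  have carrier': "A' \<in> carrier_mat n n"
    using carrier by (simp add: A'_def swap_entries_def)
  let ?E = "\<lambda>B. \<Sum>(r, c)\<in>below_diagonal n. edge_weight (coxeter_exponent B r c)"
  have exponent: "coxeter_exponent B r c = coxeter_exponent B' r' c'"
    if "B $$ (r, c) = B' $$ (r', c')" "B $$ (c, r) = -1" "B' $$ (c', r') = -1" for B B' r c r' c'
    using that by (simp add: coxeter_exponent_def)
  have "?E A' = ?E A"
  proof (rule sum.reindex_bij_witness[where i = \<tau> and j = \<tau>])
    fix p assume p: "p \<in> below_diagonal n"
    show "\<tau> (\<tau> p) = p"
      by (auto simp: \<tau>_def)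
    show "\<tau> p \<in> below_diagonal n"
      by (rule \<tau>_below_diagonal[OF p])
    then show "(case \<tau> p of (r, c) \<Rightarrow> edge_weight (coxeter_exponent A r c)) =
        (case p of (r, c) \<Rightarrow> edge_weight (coxeter_exponent A' r c))"
      using p entry[of p] upper assms(3)
      by (auto simp: below_diagonal_def split: prod.splits intro!: arg_cong[of _ _ edge_weight] exponent)
  qed (use assms(4-7) in \<open>auto simp: \<tau>_def below_diagonal_def\<close>)
  define F where "F = 1 - of_nat n * vertex_weight + ?E A"
  have "poincare_series A * F = 1"
    unfolding F_def using assms(1-3) carrier
    by (intro large_type_weyl.poincare_series_formula large_type_weylI) (auto simp: cartan_matrix_def)
  moreover have "poincare_series A' * F = 1"
    unfolding F_def \<open>?E A' = ?E A\<close>[symmetric] using carrier' diag lower upper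
    by (intro large_type_weyl.poincare_series_formula large_type_weylI)
  ultimately have "poincare_series A' = poincare_series A"
    by (metis mult.assoc mult.commute mult_1_right)
  then show ?thesis
    by (simp add: A'_def)
qed

end
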